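(* The Maslov index of a generic closed front $\gamma:S^1\to X$ is half the absolute value of the difference between its numbers of flips and flops. In other words, $$z(\gamma)=\frac12\left|\#\mathrm{flip}-\#\mathrm{flop}\right|,$$ where $\#\mathrm{flip}$ and $\#\mathrm{flop}$ denote the numbers of inflection points of each respective type.
   Context: Let $(X,\|\cdot\|)$ be a two-dimensional real normed space with unit circle $S=\{x\in X:\|x\|=1\}$. The plane is assumed smooth ($S$ is a smooth curve) and strictly convex ($S$ contains no line segment). Fix a nondegenerate symplectic (alternating) bilinear form $[\cdot,\cdot]$ on $X$. For $x,y\in X$, $x\dashv_B y$ (Birkhoff orthogonality) means $\|x+ty\|\ge\|x\|$ for all $t\in\mathbb{R}$. For $v\in X\setminus\{o\}$ let $b(v)\in S$ be the unique vector with $v\dashv_B b(v)$ and $[v,b(v)]>0$. Write $S^1=\mathbb{R}/\mathbb{Z}$. A closed front is a smooth map $\gamma:S^1\to X$ for which there is a smooth $\eta:S^1\to S$ with $\eta(t)\dashv_B\gamma'(t)$ for all $t$ and such that $\gamma'$ and $\eta'$ never vanish simultaneously; $(\gamma,\eta)$ is then called a Legendre immersion. Put $\xi=b\circ\eta$; its curvature is the pair of smooth functions $(\alpha,\kappa)$ with $\gamma'=\alpha\xi$, $\eta'=\kappa\xi$. A singular point is a $t_0$ with $\gamma'(t_0)=0$; it is an ordinary cusp if moreover $\gamma''(t_0),\gamma'''(t_0)$ are linearly independent. The closed front is generic if all its singular points are ordinary cusps and all its self-intersections are double points, i.e. whenever $t_0\ne t_1$ and $\gamma(t_0)=\gamma(t_1)$,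 the vectors $\eta(t_0),\eta(t_1)$ are linearly independent. An ordinary cusp $t_0$ is a zig if $[\eta(t_0),\eta'(t_0)]>0$ and a zag if $[\eta(t_0),\eta'(t_0)]<0$. Let $t_1<\dots<t_m$ be the ordered ordinary cusps of $\gamma$; $m$ is even. Form the word of length $m$ whose $j$-th letter is $a$ if $t_j$ is a zig and $b$ if $t_j$ is a zag. In the free product $\mathbb{Z}_2*\mathbb{Z}_2$ (with the reduction $a^2=b^2=1$) this word is of the form $(ab)^k$ or $(ba)^k$; the number $z(\gamma):=k$ is called the Maslov index (or zigzag number) of $\gamma$. An inflection point is a zero-crossing of $\kappa$. An inflection point $t_0$ is a flip if it is a zero-crossing from negative to positive of $\alpha(t)\kappa(t)$, and a flop if it is a zero-crossing from positive to negative of $\alpha(t)\kappa(t)$ (note that $\alpha(t_0)\neq0$ there).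
   Formalization: It is assumed that the front has finitely many inflection points, since otherwise the numbers of flips and of flops are both infinite and their difference is undefined; an interval of zeros of the curvature κ between opposite signs counts as one zero-crossing. *)

theory Defs
  imports "HOL-Analysis.Analysis"
begin

text \<open>Maps on the circle \<open>\<real>/\<int>\<close> are represented by 1-periodic functions on the reals; points of the
  circle are counted by their representatives in \<open>{0..<1}\<close>.\<close>

definition periodic1 :: "(real \<Rightarrow> 'b) \<Rightarrow> bool" where
  "periodic1 f \<longleftrightarrow> (\<forall>t. f (t + 1) = f t)"

definition vderiv :: "(real \<Rightarrow> 'a::real_normed_vector) \<Rightarrow> real \<Rightarrow> 'a" where
  "vderiv f t = vector_derivative f (at t)"

definition smooth_map :: "(real \<Rightarrow> 'a::real_normed_vector) \<Rightarrow> bool" where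
  "smooth_map f \<longleftrightarrow> (\<forall>n t. (vderiv ^^ n) f differentiable (at t))"

definition smooth_closed_curve :: "'a::real_normed_vector set \<Rightarrow> bool" where
  "smooth_closed_curve C \<longleftrightarrow>
     (\<exists>\<phi>. smooth_map \<phi> \<and> periodic1 \<phi> \<and> (\<forall>t. vderiv \<phi> t \<noteq> 0) \<and>
          inj_on \<phi> {0..<1} \<and> range \<phi> = C)"

definition contains_no_segment :: "'a::real_vector set \<Rightarrow> bool" where
  "contains_no_segment C \<longleftrightarrow> (\<forall>x y. x \<noteq> y \<longrightarrow> \<not> closed_segment x y \<subseteq> C)"

definition symplectic_form :: "('a::real_vector \<Rightarrow> 'a \<Rightarrow> real) \<Rightarrow> bool" where
  "symplectic_form \<omega> \<longleftrightarrow>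
     bilinear \<omega> \<and> (\<forall>x. \<omega> x x = 0) \<and> (\<forall>x. x \<noteq> 0 \<longrightarrow> (\<exists>y. \<omega> x y \<noteq> 0))"

definition birkhoff_orthogonal :: "'a::real_normed_vector \<Rightarrow> 'a \<Rightarrow> bool" where
  "birkhoff_orthogonal x y \<longleftrightarrow> (\<forall>t::real. norm x \<le> norm (x + t *\<^sub>R y))"

definition birkhoff_map ::
    "('a::real_normed_vector \<Rightarrow> 'a \<Rightarrow> real) \<Rightarrow> 'a \<Rightarrow> 'a" where
  "birkhoff_map \<omega> v = (THE w. w \<in> sphere 0 1 \<and> birkhoff_orthogonal v w \<and> \<omega> v w > 0)"

text \<open>The inequality is needed because \<open>independent {u, u}\<close> holds for every \<open>u \<noteq> 0\<close>.\<close>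

definition lin_indep2 :: "'a::real_vector \<Rightarrow> 'a \<Rightarrow> bool" where
  "lin_indep2 u v \<longleftrightarrow> u \<noteq> v \<and> independent {u, v}"

definition legendre_immersion ::
    "(real \<Rightarrow> 'a::real_normed_vector) \<Rightarrow> (real \<Rightarrow> 'a) \<Rightarrow> bool" where
  "legendre_immersion \<gamma> \<eta> \<longleftrightarrow>
     smooth_map \<gamma> \<and> periodic1 \<gamma> \<and> smooth_map \<eta> \<and> periodic1 \<eta> \<and>
     (\<forall>t. \<eta> t \<in> sphere 0 1) \<and>
     (\<forall>t. birkhoff_orthogonal (\<eta> t) (vderiv \<gamma> t)) \<and>
     (\<forall>t. \<not> (vderiv \<gamma> t = 0 \<and> vderiv \<eta> t = 0))"

text \<open>The curvature pair \<open>(\<alpha>, \<kappa>)\<close>, given by \<open>\<gamma>' = \<alpha> \<xi>\<close> and \<open>\<eta>' = \<kappa> \<xi>\<close>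
  where \<open>\<xi> = birkhoff_map \<omega> \<circ> \<eta>\<close>.\<close>

definition curvature_alpha ::
    "('a::real_normed_vector \<Rightarrow> 'a \<Rightarrow> real) \<Rightarrow> (real \<Rightarrow> 'a) \<Rightarrow> (real \<Rightarrow> 'a) \<Rightarrow> real \<Rightarrow> real" where
  "curvature_alpha \<omega> \<gamma> \<eta> t = (THE c. vderiv \<gamma> t = c *\<^sub>R birkhoff_map \<omega> (\<eta> t))"

definition curvature_kappa ::
    "('a::real_normed_vector \<Rightarrow> 'a \<Rightarrow> real) \<Rightarrow> (real \<Rightarrow> 'a) \<Rightarrow> real \<Rightarrow> real" where
  "curvature_kappa \<omega> \<eta> t = (THE c. vderiv \<eta> t = c *\<^sub>R birkhoff_map \<omega> (\<eta> t))"

definition singular_point :: "(real \<Rightarrow> 'a::real_normed_vector) \<Rightarrow> real \<Rightarrow> bool" where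
  "singular_point \<gamma> t \<longleftrightarrow> vderiv \<gamma> t = 0"

definition ordinary_cusp :: "(real \<Rightarrow> 'a::real_normed_vector) \<Rightarrow> real \<Rightarrow> bool" where
  "ordinary_cusp \<gamma> t \<longleftrightarrow>
     singular_point \<gamma> t \<and> lin_indep2 ((vderiv ^^ 2) \<gamma> t) ((vderiv ^^ 3) \<gamma> t)"

definition generic_front ::
    "(real \<Rightarrow> 'a::real_normed_vector) \<Rightarrow> (real \<Rightarrow> 'a) \<Rightarrow> bool" where
  "generic_front \<gamma> \<eta> \<longleftrightarrow>
     (\<forall>t. singular_point \<gamma> t \<longrightarrow> ordinary_cusp \<gamma> t) \<and>
     (\<forall>s\<in>{0..<1}. \<forall>t\<in>{0..<1}. s \<noteq> t \<longrightarrow> \<gamma> s = \<gamma> t \<longrightarrow> lin_indep2 (\<eta> s) (\<eta> t))"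

text \<open>Words in the generators \<open>a = Zig\<close> and \<open>b = Zag\<close> of \<open>\<int>\<^sub>2 * \<int>\<^sub>2\<close>. Two words represent the same
  element of the free product iff they are related by inserting and deleting squares of letters.\<close>

datatype letter = Zig | Zag

inductive cancel_square :: "letter list \<Rightarrow> letter list \<Rightarrow> bool" where
  "cancel_square (us @ [x, x] @ vs) (us @ vs)"

definition free_product_eq :: "letter list \<Rightarrow> letter list \<Rightarrow> bool" where
  "free_product_eq = equivclp cancel_square"

text \<open>At a cusp of a Legendre immersion \<open>\<eta>' \<noteq> 0\<close>, and every cusp is either a zig or a zag,
  i.e. \<open>\<omega> (\<eta> t) (\<eta>' t)\<close> is positive or negative.\<close>

definition cusp_letter ::
    "('a::real_normed_vector \<Rightarrow> 'a \<Rightarrow> real) \<Rightarrow> (real \<Rightarrow> 'a) \<Rightarrow> real \<Rightarrow> letter" where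
  "cusp_letter \<omega> \<eta> t = (if \<omega> (\<eta> t) (vderiv \<eta> t) > 0 then Zig else Zag)"

definition cusp_word ::
    "('a::real_normed_vector \<Rightarrow> 'a \<Rightarrow> real) \<Rightarrow> (real \<Rightarrow> 'a) \<Rightarrow> (real \<Rightarrow> 'a) \<Rightarrow> letter list" where
  "cusp_word \<omega> \<gamma> \<eta> =
     map (cusp_letter \<omega> \<eta>) (sorted_list_of_set {t \<in> {0..<1}. ordinary_cusp \<gamma> t})"

definition maslov_index ::
    "('a::real_normed_vector \<Rightarrow> 'a \<Rightarrow> real) \<Rightarrow> (real \<Rightarrow> 'a) \<Rightarrow> (real \<Rightarrow> 'a) \<Rightarrow> nat" where
  "maslov_index \<omega> \<gamma> \<eta> =
     (THE k. free_product_eq (cusp_word \<omega> \<gamma> \<eta>) (concat (replicate k [Zig, Zag])) \<or>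
             free_product_eq (cusp_word \<omega> \<gamma> \<eta>) (concat (replicate k [Zag, Zig])))"

text \<open>Zero-crossing from negative to positive. At an isolated zero this says that \<open>f < 0\<close> just before
  and \<open>f > 0\<close> just after \<open>t\<close>. If \<open>f\<close> vanishes on an interval between negative and positive values,
  this is one crossing, located at the end of that interval.\<close>

definition crosses_up :: "(real \<Rightarrow> real) \<Rightarrow> real \<Rightarrow> bool" where
  "crosses_up f t \<longleftrightarrow>
     f t = 0 \<and> (\<exists>p<t. f p < 0 \<and> (\<forall>s\<in>{p..t}. f s \<le> 0)) \<and> (\<exists>\<^sub>F s in at_right t. f s > 0)"

definition crosses_down :: "(real \<Rightarrow> real) \<Rightarrow> real \<Rightarrow> bool" where
  "crosses_down f t \<longleftrightarrow>
     f t = 0 \<and> (\<exists>p<t. f p > 0 \<and> (\<forall>s\<in>{p..t}. f s \<ge> 0)) \<and> (\<exists>\<^sub>F s in at_right t. f s < 0)"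

definition inflection_point ::
    "('a::real_normed_vector \<Rightarrow> 'a \<Rightarrow> real) \<Rightarrow> (real \<Rightarrow> 'a) \<Rightarrow> real \<Rightarrow> bool" where
  "inflection_point \<omega> \<eta> t \<longleftrightarrow>
     crosses_up (curvature_kappa \<omega> \<eta>) t \<or> crosses_down (curvature_kappa \<omega> \<eta>) t"

definition flip ::
    "('a::real_normed_vector \<Rightarrow> 'a \<Rightarrow> real) \<Rightarrow> (real \<Rightarrow> 'a) \<Rightarrow> (real \<Rightarrow> 'a) \<Rightarrow> real \<Rightarrow> bool" where
  "flip \<omega> \<gamma> \<eta> t \<longleftrightarrow>
     inflection_point \<omega> \<eta> t \<and>
     crosses_up (\<lambda>s. curvature_alpha \<omega> \<gamma> \<eta> s * curvature_kappa \<omega> \<eta> s) t"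

definition flop ::
    "('a::real_normed_vector \<Rightarrow> 'a \<Rightarrow> real) \<Rightarrow> (real \<Rightarrow> 'a) \<Rightarrow> (real \<Rightarrow> 'a) \<Rightarrow> real \<Rightarrow> bool" where
  "flop \<omega> \<gamma> \<eta> t \<longleftrightarrow>
     inflection_point \<omega> \<eta> t \<and>
     crosses_down (\<lambda>s. curvature_alpha \<omega> \<gamma> \<eta> s * curvature_kappa \<omega> \<eta> s) t"

end

theory Submission
  imports Defs
begin

text \<open>On a smooth unit circle the directions Birkhoff orthogonal to a point are those of its tangent
  line (\<open>tangent_imp_birkhoff\<close>, \<open>birkhoff_imp_tangent\<close>). Hence \<open>\<gamma>'\<close> and \<open>\<eta>'\<close> are both
  multiples of \<open>\<xi>\<close>, and \<open>\<omega> \<eta> \<xi> > 0\<close>. So the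
  curvatures \<open>\<alpha>\<close> and \<open>\<kappa>\<close> have the same signs as the functions \<open>A = \<omega> \<eta> \<gamma>'\<close> and
  \<open>K = \<omega> \<eta> \<eta>'\<close>, and the latter are differentiable because \<open>\<gamma>\<close>, \<open>\<eta>\<close> and \<open>\<omega>\<close> are. Flips, flops,
  zigs and zags depend on signs only, so they can be read off from \<open>A\<close> and \<open>K\<close>. The cusps are the
  zeros of \<open>A\<close>; there \<open>A' \<noteq> 0\<close> because the cusp is ordinary, and \<open>K \<noteq> 0\<close> because the front is
  immersed.

  The continuous periodic function \<open>A * K\<close> crosses zero upwards as often as downwards in a
  period (\<open>periodic_crossings_balance\<close>). Its crossings are of two kinds: the flips (upwards) and
  flops (downwards), where \<open>K\<close> vanishes, and the cusps, where the direction is the sign of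
  \<open>A' * K\<close>. Hence \<open>#flip - #flop\<close> is minus the sum of \<open>sgn A' * sgn K\<close> over the cusps
  (\<open>flips_minus_flops\<close>).

  The Maslov index gives the same sum. The alternating sum of the letters of a word, a zig counting
  as \<open>1\<close> and a zag as \<open>-1\<close>, does not change when a square of a letter is cancelled, because the two
  letters enter with opposite signs and all the others keep their parity. Its value on \<open>(ab)^k\<close> and
  on \<open>(ba)^k\<close> is \<open>2k\<close> and \<open>-2k\<close>, so its absolute value is twice the Maslov index
  (\<open>normal_form_exponent\<close>). For the word of a front, \<open>A'\<close> has opposite signs at consecutive cusps,
  so up to a global sign the alternating sum of the letters \<open>sgn K\<close> is again the sum of
  \<open>sgn A' * sgn K\<close> over the cusps (\<open>alternating_sum_along_zeros\<close>).\<close>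

section \<open>Zero-crossings of continuous functions\<close>

lemma crosses_up_cong_sgn:
  assumes "\<And>s. sgn (f s) = sgn (g s)"
  shows "crosses_up f t \<longleftrightarrow> crosses_up g t"
proof -
  have "f s = 0 \<longleftrightarrow> g s = 0" "f s > 0 \<longleftrightarrow> g s > 0" "f s < 0 \<longleftrightarrow> g s < 0" "f s \<le> 0 \<longleftrightarrow> g s \<le> 0" for s
    using assms[of s] by (auto simp: sgn_real_def split: if_splits)
  then show ?thesis by (simp add: crosses_up_def)
qed

lemma crosses_down_uminus: "crosses_down f t \<longleftrightarrow> crosses_up (\<lambda>s. - f s) t"
  by (simp add: crosses_up_def crosses_down_def)

lemma crosses_up_uminus: "crosses_up f t \<longleftrightarrow> crosses_down (\<lambda>s. - f s) t"
  by (simp add: crosses_up_def crosses_down_def)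

lemma crosses_down_cong_sgn:
  assumes "\<And>s. sgn (f s) = sgn (g s)"
  shows "crosses_down f t \<longleftrightarrow> crosses_down g t"
  unfolding crosses_down_uminus
  by (rule crosses_up_cong_sgn) (simp add: sgn_minus assms)

lemma not_crosses_up_and_down: "\<not> (crosses_up f t \<and> crosses_down f t)"
proof
  assume *: "crosses_up f t \<and> crosses_down f t"
  obtain p where p: "p < t" "f p < 0" "\<forall>s\<in>{p..t}. f s \<le> 0"
    using * unfolding crosses_up_def by blast
  obtain q where q: "q < t" "f q > 0" "\<forall>s\<in>{q..t}. f s \<ge> 0"
    using * unfolding crosses_down_def by blast
  show False
    using p(3)[rule_format, of q] q(3)[rule_format, of p] p(1,2) q(1,2) by fastforce
qed

lemma crosses_up_zero: "crosses_up f t \<Longrightarrow> f t = 0"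
  by (simp add: crosses_up_def)

lemma crosses_down_zero: "crosses_down f t \<Longrightarrow> f t = 0"
  by (simp add: crosses_down_def)

lemma crosses_up_between:
  fixes f :: "real \<Rightarrow> real"
  assumes cont: "continuous_on UNIV f" and ab: "a < b" "f a < 0" "f b > 0"
  shows "\<exists>t\<in>{a<..<b}. crosses_up f t"
proof -
  define T where "T = {s\<in>{a..b}. f s > 0}"
  \<comment> \<open>The crossing is where \<open>f\<close> first stops being nonpositive.\<close>
  define t where "t = Inf T"
  have bT: "b \<in> T" using ab by (auto simp: T_def)
  have bdd: "bdd_below T" unfolding T_def by (rule bdd_belowI[of _ a]) auto
  have at: "a \<le> t" unfolding t_def using bT by (intro cInf_greatest) (auto simp: T_def)
  have tb: "t \<le> b" unfolding t_def by (rule cInf_lower[OF bT bdd])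
  have below: "f s \<le> 0" if "a \<le> s" "s < t" for s
  proof (rule ccontr)
    assume "\<not> f s \<le> 0"
    then have "s \<in> T" using that tb by (auto simp: T_def)
    from cInf_lower[OF this bdd] that show False unfolding t_def by simp
  qed
  have isc: "isCont f t" using cont by (simp add: continuous_on_eq_continuous_at)
  have nlt: "\<not> f t < 0"
  proof
    assume "f t < 0"
    then have "eventually (\<lambda>s. f s < 0) (at t)"
      using isc unfolding isCont_def by (rule order_tendstoD(2)[rotated])
    then have "eventually (\<lambda>s. f s < 0) (at_right t)"
      by (simp add: eventually_at_split)
    then obtain e where e: "e > t" "\<And>y. t < y \<Longrightarrow> y < e \<Longrightarrow> f y < 0"
      by (auto simp: eventually_at_right_field)
    obtain s where s: "s \<in> T" "s < e"
      using cInf_lessD[of T e] bT e(1) unfolding t_def by blast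
    have "t \<le> s" unfolding t_def by (rule cInf_lower[OF s(1) bdd])
    then show False using e(2)[of s] s \<open>f t < 0\<close> by (cases "s = t") (auto simp: T_def)
  qed
  have ngt: "\<not> f t > 0"
  proof
    assume *: "f t > 0"
    then have "a < t" using at ab by (cases "a = t") auto
    have "eventually (\<lambda>s. f s > 0) (at t)"
      using isc * unfolding isCont_def by (rule order_tendstoD(1))
    then have "eventually (\<lambda>s. f s > 0) (at_left t)"
      by (simp add: eventually_at_split)
    then obtain e where e: "e < t" "\<And>y. e < y \<Longrightarrow> y < t \<Longrightarrow> f y > 0"
      by (auto simp: eventually_at_left_field)
    obtain y where "max a e < y" "y < t" using dense[of "max a e" t] \<open>a < t\<close> e(1) by auto
    then show False using e(2)[of y] below[of y] by auto
  qed
  have t0: "f t = 0" using nlt ngt by linarith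
  have "a < t" "t < b" using t0 at tb ab by (auto simp: order_less_le)
  have "\<exists>\<^sub>F s in at_right t. f s > 0"
  proof (rule ccontr)
    assume "\<not> (\<exists>\<^sub>F s in at_right t. f s > 0)"
    then obtain e where e: "e > t" "\<And>y. t < y \<Longrightarrow> y < e \<Longrightarrow> \<not> f y > 0"
      by (auto simp: frequently_def eventually_at_right_field)
    obtain s where s: "s \<in> T" "s < e"
      using cInf_lessD[of T e] bT e(1) unfolding t_def by blast
    have "t \<le> s" unfolding t_def by (rule cInf_lower[OF s(1) bdd])
    then show False using e(2)[of s] s t0 by (cases "s = t") (auto simp: T_def)
  qed
  moreover have "\<forall>s\<in>{a..t}. f s \<le> 0" using below t0 by force
  ultimately show ?thesis
    unfolding crosses_up_def using t0 \<open>a < t\<close> \<open>t < b\<close> ab by auto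
qed

lemma crosses_down_between:
  fixes f :: "real \<Rightarrow> real"
  assumes "continuous_on UNIV f" "a < b" "f a > 0" "f b < 0"
  shows "\<exists>t\<in>{a<..<b}. crosses_down f t"
  unfolding crosses_down_uminus
  by (rule crosses_up_between) (use assms in \<open>auto intro: continuous_intros\<close>)

text \<open>The local step of the count: an upward crossing at \<open>t\<close> can be separated from the later crossings
  by a point \<open>c\<close> with \<open>f c > 0\<close>. Finiteness of the set of crossings is what keeps them from
  accumulating at \<open>t\<close> from the right.\<close>

lemma first_crossing_up:
  fixes f :: "real \<Rightarrow> real"
  assumes cont: "continuous_on UNIV f" and ne: "f a \<noteq> 0" and t: "a < t" "t < b" "crosses_up f t"
    and fin: "finite {s\<in>{a<..<b}. crosses_up f s \<or> crosses_down f s}"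
    and first: "\<And>s. s \<in> {a<..<t} \<Longrightarrow> \<not> crosses_down f s"
  shows "f a < 0"
    and "\<exists>c. t < c \<and> c < b \<and> f c > 0 \<and> (\<forall>s\<in>{t<..c}. \<not> (crosses_up f s \<or> crosses_down f s))"
proof -
  obtain p where p: "p < t" "f p < 0" "\<forall>s\<in>{p..t}. f s \<le> 0"
    using t(3) unfolding crosses_up_def by blast
  show "f a < 0"
  proof (rule ccontr)
    assume "\<not> f a < 0"
    then have fa: "f a > 0" using ne by simp
    have "a < p"
    proof (rule ccontr)
      assume "\<not> a < p"
      then have "f a \<le> 0" using p t by auto
      with fa show False by simp
    qed
    from crosses_down_between[OF cont this fa p(2)] first p(1) show False by force
  qed
  \<comment> \<open>The next crossing after \<open>t\<close>, or \<open>b\<close> if there is none.\<close>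
  let ?D = "{s\<in>{a<..<b}. crosses_up f s \<or> crosses_down f s} \<inter> {t<..}"
  define d where "d = Min (insert b ?D)"
  have finD: "finite (insert b ?D)" using fin by simp
  have "t < d" unfolding d_def using finD t by (subst Min_gr_iff) auto
  then have "eventually (\<lambda>s. s \<in> {t<..<d}) (at_right t)" by (rule eventually_at_right_real)
  moreover have "\<exists>\<^sub>F s in at_right t. f s > 0" using t(3) by (simp add: crosses_up_def)
  ultimately have "\<exists>\<^sub>F s in at_right t. f s > 0 \<and> s \<in> {t<..<d}"
    by (intro frequently_eventually_frequently)
  then obtain c where c: "f c > 0" "t < c" "c < d" by (auto dest: frequently_ex)
  have db: "d \<le> b" unfolding d_def using finD by (rule Min_le) simp
  have "\<not> (crosses_up f s \<or> crosses_down f s)" if s: "s \<in> {t<..c}" for s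
  proof
    assume "crosses_up f s \<or> crosses_down f s"
    then have "s \<in> insert b ?D" using s t c db by auto
    from Min_le[OF finD this] s c show False unfolding d_def by auto
  qed
  then show "\<exists>c. t < c \<and> c < b \<and> f c > 0 \<and> (\<forall>s\<in>{t<..c}. \<not> (crosses_up f s \<or> crosses_down f s))"
    using c db by (intro exI[of _ c]) auto
qed

text \<open>Each crossing changes the sign of \<open>f\<close> from one value to the other and nothing else does, so the
  signed number of crossings telescopes. The induction splits off the first crossing.\<close>

lemma net_crossings:
  fixes f :: "real \<Rightarrow> real"
  assumes "continuous_on UNIV f" "a < b" "f a \<noteq> 0" "f b \<noteq> 0"
    and "finite {t\<in>{a<..<b}. crosses_up f t \<or> crosses_down f t}"
  shows "2 * (real (card {t\<in>{a<..<b}. crosses_up f t}) - real (card {t\<in>{a<..<b}. crosses_down f t}))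
    = sgn (f b) - sgn (f a)"
  using assms
proof (induction "card {t\<in>{a<..<b}. crosses_up f t \<or> crosses_down f t}" arbitrary: f a)
  case 0
  then have none: "\<not> crosses_up f t" "\<not> crosses_down f t" if "t \<in> {a<..<b}" for t
    using that by auto
  have "sgn (f b) = sgn (f a)"
    using crosses_up_between[of f a b] crosses_down_between[of f a b] none 0
    by (cases "f a > 0"; cases "f b > 0") auto
  moreover have "{t\<in>{a<..<b}. crosses_up f t} = {}" "{t\<in>{a<..<b}. crosses_down f t} = {}"
    using none by auto
  ultimately show ?case by (simp only: card.empty diff_self mult_zero_right of_nat_0)
next
  case (Suc n)
  let ?C = "\<lambda>f a. {t\<in>{a<..<b}. crosses_up f t \<or> crosses_down f t}"
  let ?U = "\<lambda>f a. {t\<in>{a<..<b}. crosses_up f t}"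
  let ?D = "\<lambda>f a. {t\<in>{a<..<b}. crosses_down f t}"
  \<comment> \<open>The case of a first crossing that goes up; the other case is this one for \<open>- f\<close>.\<close>
  have step: "2 * (real (card (?U g a)) - real (card (?D g a))) = sgn (g b) - sgn (g a)"
    if g: "continuous_on UNIV g" "g a \<noteq> 0" "g b \<noteq> 0" "finite (?C g a)" "Suc n = card (?C g a)"
      and t: "t = Min (?C g a)" "crosses_up g t" for g t
  proof -
    have "?C g a \<noteq> {}" using g(5) by (metis card.empty nat.distinct(1))
    then have tC: "t \<in> ?C g a" unfolding t(1) using g(4) by (intro Min_in)
    have first: "\<not> (crosses_up g s \<or> crosses_down g s)" if "s \<in> {a<..<t}" for s
      using Min_le[OF g(4), of s] that tC unfolding t(1)[symmetric] by auto
    have at: "a < t" "t < b" using tC by auto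
    have ga: "g a < 0"
      by (rule first_crossing_up[OF g(1,2) at t(2) g(4)]) (use first in auto)
    have "\<exists>c. t < c \<and> c < b \<and> g c > 0 \<and> (\<forall>s\<in>{t<..c}. \<not> (crosses_up g s \<or> crosses_down g s))"
      by (rule first_crossing_up[OF g(1,2) at t(2) g(4)]) (use first in auto)
    then obtain c where c: "t < c" "c < b" "g c > 0"
      "\<And>s. s \<in> {t<..c} \<Longrightarrow> \<not> (crosses_up g s \<or> crosses_down g s)" by blast
    have gap: "s = t \<or> c < s" if "s \<in> ?C g a" for s
    proof (rule ccontr)
      assume "\<not> (s = t \<or> c < s)"
      then have "s \<in> {a<..<t} \<or> s \<in> {t<..c}" using that by auto
      then show False using c(4)[of s] first[of s] that by blast
    qed
    have U: "?U g a = insert t (?U g c)"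
    proof (intro equalityI subsetI)
      fix s assume "s \<in> ?U g a"
      then show "s \<in> insert t (?U g c)" using gap[of s] by auto
    qed (use t(2) at c in auto)
    have D: "?D g a = ?D g c"
    proof (intro equalityI subsetI)
      fix s assume "s \<in> ?D g a"
      then show "s \<in> ?D g c" using gap[of s] not_crosses_up_and_down[of g t] t(2) by auto
    qed (use at c in auto)
    have C: "?C g a = insert t (?C g c)"
    proof (intro equalityI subsetI)
      fix s assume "s \<in> ?C g a"
      then show "s \<in> insert t (?C g c)" using gap[of s] by auto
    qed (use t(2) at c in auto)
    have finC: "finite (?C g c)" using g(4) C by simp
    have tn: "t \<notin> ?C g c" using c by auto
    have n: "n = card (?C g c)"
      using g(5) unfolding C card_insert_disjoint[OF finC tn] by simp
    have IH: "2 * (real (card (?U g c)) - real (card (?D g c))) = sgn (g b) - sgn (g c)"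
      using Suc.hyps(1)[of c g, OF n g(1) c(2) _ g(3) finC] c(3) by simp
    have "finite (?U g c)" by (rule finite_subset[OF _ finC]) auto
    then have "card (?U g a) = Suc (card (?U g c))"
      unfolding U using c by (subst card_insert_disjoint) auto
    then show ?thesis using IH ga c(3) unfolding D by (simp add: sgn_real_def)
  qed
  define t where "t = Min (?C f a)"
  have "?C f a \<noteq> {}" using Suc.hyps(2) by (metis card.empty nat.distinct(1))
  then have tC: "t \<in> ?C f a" unfolding t_def using Suc.prems(5) by (intro Min_in)
  then consider "crosses_up f t" | "crosses_down f t" by blast
  then show ?case
  proof cases
    case 1
    show ?thesis by (rule step[OF Suc.prems(1,3,4,5) Suc.hyps(2) t_def 1])
  next
    case 2
    let ?g = "\<lambda>s. - f s"
    have C: "?C ?g a = ?C f a"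
      by (auto simp: crosses_up_uminus[of f] crosses_down_uminus[of f])
    have U: "?U ?g a = ?D f a" by (simp add: crosses_down_uminus[of f])
    have D: "?D ?g a = ?U f a" by (simp add: crosses_up_uminus[of f])
    have "2 * (real (card (?U ?g a)) - real (card (?D ?g a))) = sgn (?g b) - sgn (?g a)"
    proof (rule step[where t = t])
      show "continuous_on UNIV ?g" by (intro continuous_intros Suc.prems(1))
      show "finite (?C ?g a)" unfolding C by (rule Suc.prems(5))
      show "Suc n = card (?C ?g a)" unfolding C by (rule Suc.hyps(2))
      show "t = Min (?C ?g a)" unfolding C by (rule t_def)
      show "crosses_up ?g t" using 2 by (simp add: crosses_down_uminus)
    qed (use Suc.prems in auto)
    then show ?thesis unfolding U D by (simp add: sgn_minus)
  qed
qed

text \<open>Counts over the period \<open>{0..<1}\<close> are moved to a period that starts at a chosen \<open>a\<close>, which is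
  needed because \<open>net_crossings\<close> asks for a nonzero value at the endpoints.\<close>

lemma card_period_shift:
  fixes P :: "real \<Rightarrow> bool"
  assumes per: "\<And>t. P (t + 1) \<longleftrightarrow> P t" and a: "0 \<le> a" "a < 1" "\<not> P a"
    and fin: "finite {t\<in>{0..<1}. P t}"
  shows "finite {t\<in>{a<..<a+1}. P t}" "card {t\<in>{a<..<a+1}. P t} = card {t\<in>{0..<1}. P t}"
proof -
  let ?L = "{t\<in>{0..<a}. P t}" and ?R = "{t\<in>{a<..<1}. P t}"
  have eq1: "{t\<in>{0..<1}. P t} = ?L \<union> ?R" using a by (auto simp: order_less_le)
  have eq2: "{t\<in>{a<..<a+1}. P t} = (\<lambda>t. t + 1) ` ?L \<union> ?R"
  proof (intro equalityI subsetI)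
    fix x assume x: "x \<in> {t\<in>{a<..<a+1}. P t}"
    show "x \<in> (\<lambda>t. t + 1) ` ?L \<union> ?R"
    proof (cases "x < 1")
      case False
      then have "x - 1 \<in> ?L" using x per[of "x - 1"] by auto
      then show ?thesis by (intro UnI1 image_eqI[of _ _ "x - 1"]) auto
    qed (use x in auto)
  next
    fix x assume "x \<in> (\<lambda>t. t + 1) ` ?L \<union> ?R"
    then consider t where "t \<in> ?L" "x = t + 1" | "x \<in> ?R" by blast
    then show "x \<in> {t\<in>{a<..<a+1}. P t}"
    proof cases
      case 1
      then show ?thesis using a(2) per[of t] by simp
    qed (use a(1) in simp)
  qed
  have f: "finite ?L" "finite ?R" using fin unfolding eq1 by auto
  then show "finite {t\<in>{a<..<a+1}. P t}" unfolding eq2 by auto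
  have "card ((\<lambda>t. t + 1) ` ?L \<union> ?R) = card ((\<lambda>t. t + 1) ` ?L) + card ?R"
    using f by (intro card_Un_disjoint) auto
  also have "\<dots> = card ?L + card ?R" by (subst card_image) auto
  also have "\<dots> = card (?L \<union> ?R)" using f by (intro card_Un_disjoint[symmetric]) auto
  finally show "card {t\<in>{a<..<a+1}. P t} = card {t\<in>{0..<1}. P t}" unfolding eq1 eq2 .
qed

lemma crosses_up_shift: 
  assumes "periodic1 f" shows "crosses_up f (t + 1) \<longleftrightarrow> crosses_up f t"
proof -
  have per: "f (s + 1) = f s" "f (s - 1) = f s" for s
    using assms unfolding periodic1_def by (metis, metis diff_add_cancel)
  have F: "(\<exists>\<^sub>F s in at_right (t + 1). f s > 0) \<longleftrightarrow> (\<exists>\<^sub>F s in at_right t. f s > 0)"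
  proof -
    have "at_right (t + 1) = filtermap (\<lambda>s. s + 1) (at_right t)"
      using at_right_to_0[of t] at_right_to_0[of "t + 1"] by (simp add: filtermap_filtermap algebra_simps)
    then show ?thesis by (simp add: frequently_def eventually_filtermap per)
  qed
  have "(\<exists>p<t + 1. f p < 0 \<and> (\<forall>s\<in>{p..t + 1}. f s \<le> 0)) \<longleftrightarrow> (\<exists>p<t. f p < 0 \<and> (\<forall>s\<in>{p..t}. f s \<le> 0))"
    (is "?l \<longleftrightarrow> ?r")
  proof
    assume ?l
    then obtain p where p: "p < t + 1" "f p < 0" "\<forall>s\<in>{p..t + 1}. f s \<le> 0" by blast
    have "f s \<le> 0" if "s \<in> {p - 1..t}" for s using p(3)[rule_format, of "s + 1"] that per by auto
    then show ?r using p per by (intro exI[of _ "p - 1"]) auto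
  next
    assume ?r
    then obtain p where p: "p < t" "f p < 0" "\<forall>s\<in>{p..t}. f s \<le> 0" by blast
    have "f s \<le> 0" if "s \<in> {p + 1..t + 1}" for s using p(3)[rule_format, of "s - 1"] that per by auto
    then show ?l using p per by (intro exI[of _ "p + 1"]) auto
  qed
  then show ?thesis unfolding crosses_up_def F per by simp
qed

lemma crosses_down_shift: 
  assumes "periodic1 f" shows "crosses_down f (t + 1) \<longleftrightarrow> crosses_down f t"
  unfolding crosses_down_uminus
  by (rule crosses_up_shift) (use assms in \<open>simp add: periodic1_def\<close>)

lemma periodic_crossings_balance:
  fixes f :: "real \<Rightarrow> real"
  assumes cont: "continuous_on UNIV f" and per: "periodic1 f"
    and fin: "finite {t\<in>{0..<1}. crosses_up f t \<or> crosses_down f t}"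
  shows "card {t\<in>{0..<1}. crosses_up f t} = card {t\<in>{0..<1}. crosses_down f t}"
proof (cases "\<exists>a\<in>{0..<1}. f a \<noteq> 0")
  case False
  then have "f t = 0" for t
  proof -
    have *: "f (s + of_int n) = f s" for s n
    proof (induction n rule: int_induct[where k = 0])
      case (step1 i) then show ?case using per unfolding periodic1_def
        by (metis add.assoc of_int_1 of_int_add)
    next
      case (step2 i) then show ?case using per unfolding periodic1_def
        by (metis add_diff_eq diff_add_cancel of_int_1 of_int_diff)
    qed simp
    have "f (frac t) = 0" using False frac_lt_1[of t] by auto
    then show ?thesis using *[of "frac t" "\<lfloor>t\<rfloor>"] by (simp add: frac_def)
  qed
  then show ?thesis by (simp add: crosses_up_def crosses_down_def)
next
  case True
  then obtain a where a: "0 \<le> a" "a < 1" "f a \<noteq> 0" by auto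
  have na: "\<not> crosses_up f a" "\<not> crosses_down f a"
    using a crosses_up_zero crosses_down_zero by blast+
  note shift = crosses_up_shift[OF per] crosses_down_shift[OF per]
  have fin': "finite {t\<in>{a<..<a+1}. crosses_up f t \<or> crosses_down f t}"
    by (rule card_period_shift(1)) (use a na fin in \<open>auto simp: shift\<close>)
  have U: "card {t\<in>{a<..<a+1}. crosses_up f t} = card {t\<in>{0..<1}. crosses_up f t}"
    by (rule card_period_shift(2)) (use a na in \<open>auto simp: shift intro: finite_subset[OF _ fin]\<close>)
  have D: "card {t\<in>{a<..<a+1}. crosses_down f t} = card {t\<in>{0..<1}. crosses_down f t}"
    by (rule card_period_shift(2)) (use a na in \<open>auto simp: shift intro: finite_subset[OF _ fin]\<close>)
  have "f (a + 1) = f a" using per by (simp add: periodic1_def)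
  with net_crossings[OF cont _ a(3) _ fin'] a show ?thesis unfolding U D by simp
qed

section \<open>Words in two involutions\<close>

primrec alternating_sum :: "real list \<Rightarrow> real" where
  "alternating_sum [] = 0"
| "alternating_sum (x # xs) = x - alternating_sum xs"

primrec letter_sign :: "letter \<Rightarrow> real" where
  "letter_sign Zig = 1"
| "letter_sign Zag = -1"

lemma alternating_sum_append:
  "alternating_sum (xs @ ys) = alternating_sum xs + (-1) ^ length xs * alternating_sum ys"
  by (induction xs) auto

lemma free_product_eq_alternating_sum:
  assumes "free_product_eq u v"
  shows "alternating_sum (map letter_sign u) = alternating_sum (map letter_sign v)"
  using assms unfolding free_product_eq_def
proof (induction rule: equivclp_induct)
  case (step y z)
  have "cancel_square p r \<Longrightarrow>
      alternating_sum (map letter_sign p) = alternating_sum (map letter_sign r)" for p r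
    by (induction rule: cancel_square.induct) (simp add: alternating_sum_append)
  with step show ?case by metis
qed simp

lemma alternating_sum_ZigZag_power:
  "alternating_sum (map letter_sign (concat (replicate k [Zig, Zag]))) = 2 * real k"
  by (induction k) auto

lemma alternating_sum_ZagZig_power:
  "alternating_sum (map letter_sign (concat (replicate k [Zag, Zig]))) = - 2 * real k"
  by (induction k) auto

lemma free_product_eq_append_left:
  assumes "free_product_eq u v"
  shows "free_product_eq (w @ u) (w @ v)"
  using assms unfolding free_product_eq_def
proof (induction rule: equivclp_induct)
  case (step y z)
  have "cancel_square p r \<Longrightarrow> cancel_square (w @ p) (w @ r)" for p r
    by (induction rule: cancel_square.induct)
      (metis append.assoc cancel_square.intros)
  with step show ?case by (metis equivclp_into_equivclp)
qed simp

lemma free_product_eq_trans [trans]: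
  "free_product_eq u v \<Longrightarrow> free_product_eq v w \<Longrightarrow> free_product_eq u w"
  unfolding free_product_eq_def by (rule equivclp_trans)

lemma free_product_eq_cancel: "free_product_eq (us @ [x, x] @ vs) (us @ vs)"
  unfolding free_product_eq_def by (intro r_into_equivclp cancel_square.intros)

lemma free_product_eq_refl [simp]: "free_product_eq u u"
  by (simp add: free_product_eq_def)

text \<open>The letters are taken off in pairs: an equal pair cancels, and an unequal pair either lengthens the
  normal form of the rest or cancels against its first pair.\<close>

lemma even_word_normal_form:
  "even (length w) \<Longrightarrow> \<exists>k. free_product_eq w (concat (replicate k [Zig, Zag])) \<or>
     free_product_eq w (concat (replicate k [Zag, Zig]))"
proof (induction w rule: induct_list012)
  case 1
  then show ?case by (intro exI[of _ 0]) simp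
next
  case (3 x y w)
  \<comment> \<open>Prefixing \<open>[u, v]\<close> to a power of \<open>[u, v]\<close> or of \<open>[v, u]\<close>, with \<open>u \<noteq> v\<close>.\<close>
  have same: "free_product_eq ([u, v] @ w) (concat (replicate (Suc k) [u, v]))"
    if "free_product_eq w (concat (replicate k [u, v]))" for k u v
    using free_product_eq_append_left[OF that, of "[u, v]"] by simp
  have opp: "\<exists>j. free_product_eq ([u, v] @ w) (concat (replicate j [u, v])) \<or>
      free_product_eq ([u, v] @ w) (concat (replicate j [v, u]))"
    if w: "free_product_eq w (concat (replicate k [v, u]))" for k u v
  proof (cases k)
    case 0
    then have "free_product_eq ([u, v] @ w) (concat (replicate (Suc 0) [u, v]))"
      using same[of 0 u v] w by simp
    then show ?thesis by blast
  next
    case (Suc j)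
    let ?r = "concat (replicate j [v, u])"
    have "free_product_eq ([u, v] @ w) ([u] @ [v, v] @ [u] @ ?r)"
      using free_product_eq_append_left[OF w, of "[u, v]"] by (simp add: Suc)
    also have "free_product_eq ([u] @ [v, v] @ [u] @ ?r) ([] @ [u, u] @ ?r)"
      using free_product_eq_cancel[of "[u]" v "[u] @ ?r"] by simp
    also have "free_product_eq ([] @ [u, u] @ ?r) ?r"
      using free_product_eq_cancel[of "[]" u ?r] by simp
    finally show ?thesis by blast
  qed
  from 3 obtain k where k: "free_product_eq w (concat (replicate k [Zig, Zag])) \<or>
     free_product_eq w (concat (replicate k [Zag, Zig]))" by auto
  show ?case
  proof (cases "x = y")
    case True
    have "free_product_eq (x # y # w) w"
      using free_product_eq_cancel[of "[]" x w] True by simp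
    then show ?thesis using k free_product_eq_trans by blast
  next
    case False
    then consider "x = Zig" "y = Zag" | "x = Zag" "y = Zig" by (metis letter.exhaust)
    then show ?thesis
    proof cases
      case 1
      from k show ?thesis
      proof
        assume "free_product_eq w (concat (replicate k [Zig, Zag]))"
        from same[OF this] show ?thesis unfolding 1 by (intro exI[of _ "Suc k"]) simp
      next
        assume "free_product_eq w (concat (replicate k [Zag, Zig]))"
        from opp[OF this] show ?thesis unfolding 1 by simp
      qed
    next
      case 2
      from k show ?thesis
      proof
        assume "free_product_eq w (concat (replicate k [Zag, Zig]))"
        from same[OF this] show ?thesis unfolding 2 by (intro exI[of _ "Suc k"]) simp
      next
        assume "free_product_eq w (concat (replicate k [Zig, Zag]))"
        from opp[OF this] show ?thesis unfolding 2 by (simp add: disj_commute)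
      qed
    qed
  qed
qed simp

text \<open>The alternating sum determines \<open>k\<close> from either of the two normal forms, so the description defining
  the Maslov index has exactly one solution.\<close>

lemma normal_form_exponent:
  assumes "even (length w)"
  shows "2 * real (THE k. free_product_eq w (concat (replicate k [Zig, Zag])) \<or>
             free_product_eq w (concat (replicate k [Zag, Zig])))
    = \<bar>alternating_sum (map letter_sign w)\<bar>" (is "2 * real (The ?P) = _")
proof -
  have val: "2 * real k = \<bar>alternating_sum (map letter_sign w)\<bar>" if "?P k" for k
    using that free_product_eq_alternating_sum[of w "concat (replicate k [Zig, Zag])"]
      free_product_eq_alternating_sum[of w "concat (replicate k [Zag, Zig])"]
    by (auto simp: alternating_sum_ZigZag_power alternating_sum_ZagZig_power)
  obtain k where k: "?P k" using even_word_normal_form[OF assms] by blast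
  have "The ?P = k"
  proof (rule the_equality)
    fix j assume "?P j"
    from val[OF this] val[OF k] show "j = k" by simp
  qed (rule k)
  then show ?thesis using val[OF k] by (simp only:)
qed

text \<open>If the signs \<open>e\<close> alternate along the list, then the signs of the alternating sum are \<open>e\<close> itself,
  up to the factor that makes the first one positive.\<close>

lemma alternating_sum_alternating_signs:
  assumes "successively (\<lambda>s t. e s = - e t) (x # xs)" "\<And>t. t \<in> set (x # xs) \<Longrightarrow> \<bar>e t\<bar> = (1::real)"
  shows "alternating_sum (map f (x # xs)) = e x * (\<Sum>t\<leftarrow>x # xs. e t * f t)"
  using assms
proof (induction xs arbitrary: x)
  case Nil
  then have "e x * e x = 1" by (metis abs_mult_self_eq list.set_intros(1) mult_1)
  then show ?case by simp
next
  case (Cons y ys)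
  let ?S = "\<Sum>t\<leftarrow>y # ys. e t * f t"
  have sq: "e x * e x = 1"
    using Cons.prems(2)[of x] by (metis abs_mult_self_eq list.set_intros(1) mult_1)
  have "alternating_sum (map f (x # y # ys)) = f x - alternating_sum (map f (y # ys))" by simp
  also have "alternating_sum (map f (y # ys)) = e y * ?S"
    by (rule Cons.IH) (use Cons.prems in auto)
  also have "e y = - e x" using Cons.prems(1) by simp
  also have "f x - (- e x) * ?S = (e x * e x) * f x + e x * ?S" by (simp add: sq)
  also have "\<dots> = e x * (\<Sum>t\<leftarrow>x # y # ys. e t * f t)" by (simp add: distrib_left)
  finally show ?case .
qed

section \<open>Zeros with nonzero derivative\<close>

lemma simple_zero_sign_right:
  fixes f :: "real \<Rightarrow> real"
  assumes "(f has_real_derivative d) (at t)" "f t = 0" "d \<noteq> 0"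
  shows "eventually (\<lambda>s. sgn (f s) = sgn d) (at_right t)"
proof (cases "d > 0")
  case True
  obtain e where e: "e > 0" "\<And>h. h > 0 \<Longrightarrow> h < e \<Longrightarrow> f t < f (t + h)"
    using DERIV_pos_inc_right[OF assms(1) True] by blast
  have "sgn (f s) = sgn d" if "t < s" "s < t + e" for s
    using e(2)[of "s - t"] that assms(2) True by simp
  then show ?thesis using e(1) by (auto simp: eventually_at_right_field intro!: exI[of _ "t + e"])
next
  case False
  then have d: "d < 0" using assms(3) by simp
  obtain e where e: "e > 0" "\<And>h. h > 0 \<Longrightarrow> h < e \<Longrightarrow> f t > f (t + h)"
    using DERIV_neg_dec_right[OF assms(1) d] by blast
  have "sgn (f s) = sgn d" if "t < s" "s < t + e" for s
    using e(2)[of "s - t"] that assms(2) d by simp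
  then show ?thesis using e(1) by (auto simp: eventually_at_right_field intro!: exI[of _ "t + e"])
qed

lemma simple_zero_sign_left:
  fixes f :: "real \<Rightarrow> real"
  assumes "(f has_real_derivative d) (at t)" "f t = 0" "d \<noteq> 0"
  shows "eventually (\<lambda>s. sgn (f s) = - sgn d) (at_left t)"
proof -
  have "((\<lambda>s. f (- s)) has_real_derivative - d) (at (- t))"
    by (rule DERIV_mirror[THEN iffD1]) (use assms in simp)
  from simple_zero_sign_right[OF this] assms
  have "eventually (\<lambda>s. sgn (f (- s)) = - sgn d) (at_right (- t))" by (simp add: sgn_minus)
  then show ?thesis
    by (subst at_left_minus) (simp add: eventually_filtermap)
qed

lemma simple_zero_crosses_up:
  fixes f :: "real \<Rightarrow> real"
  assumes der: "(f has_real_derivative d) (at t)" and t0: "f t = 0" and d: "d > 0"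
  shows "crosses_up f t"
proof -
  have "eventually (\<lambda>s. f s < 0) (at_left t)"
    using simple_zero_sign_left[OF der t0] d by (auto elim!: eventually_mono simp: sgn_real_def split: if_splits)
  then obtain r where r: "r < t" "\<And>s. r < s \<Longrightarrow> s < t \<Longrightarrow> f s < 0"
    by (auto simp: eventually_at_left_field)
  obtain p where p: "r < p" "p < t" using dense[OF r(1)] by blast
  have "f s \<le> 0" if "s \<in> {p..t}" for s
    using r(2)[of s] that p t0 by (cases "s = t") auto
  moreover have "eventually (\<lambda>s. f s > 0) (at_right t)"
    using simple_zero_sign_right[OF der t0] d by (auto elim!: eventually_mono simp: sgn_real_def split: if_splits)
  then have "\<exists>\<^sub>F s in at_right t. f s > 0" by (intro eventually_frequently) auto
  moreover have "f p < 0" using r(2) p by simp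
  ultimately show ?thesis unfolding crosses_up_def using t0 p(2) by blast
qed

lemma simple_zero_crosses_down:
  fixes f :: "real \<Rightarrow> real"
  assumes "(f has_real_derivative d) (at t)" "f t = 0" "d < 0"
  shows "crosses_down f t"
  unfolding crosses_down_uminus
  by (rule simple_zero_crosses_up[where d = "- d"]) (use assms in \<open>auto intro: DERIV_minus\<close>)

lemma simple_zero_crosses_iff:
  fixes f :: "real \<Rightarrow> real"
  assumes "(f has_real_derivative d) (at t)" "f t = 0" "d \<noteq> 0"
  shows "crosses_up f t \<longleftrightarrow> d > 0" "crosses_down f t \<longleftrightarrow> d < 0"
  using simple_zero_crosses_up[OF assms(1,2)] simple_zero_crosses_down[OF assms(1,2)]
    not_crosses_up_and_down[of f t] assms(3) by (cases "d > 0"; auto)+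

text \<open>An accumulation point of zeros would be a zero by continuity, but a zero with nonzero derivative
  is isolated.\<close>

lemma finite_simple_zeros:
  fixes f :: "real \<Rightarrow> real"
  assumes der: "\<And>t. (f has_real_derivative f' t) (at t)" and simple: "\<And>t. f t = 0 \<Longrightarrow> f' t \<noteq> 0"
  shows "finite {t\<in>{a..b}. f t = 0}"
proof (rule ccontr)
  assume inf: "infinite {t\<in>{a..b}. f t = 0}"
  obtain x where x: "x islimpt {t\<in>{a..b}. f t = 0}"
    using Heine_Borel_imp_Bolzano_Weierstrass[OF compact_Icc[of a b] inf] by blast
  have "continuous_on UNIV f"
    using der by (meson DERIV_isCont continuous_at_imp_continuous_on)
  then have "closed {t. f t = 0}" by (intro closed_Collect_eq) auto
  then have x0: "f x = 0"
    using x islimpt_subset[OF x, of "{t. f t = 0}"] by (auto simp: closed_limpt)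
  note right = simple_zero_sign_right[OF der x0 simple[OF x0]]
  note left = simple_zero_sign_left[OF der x0 simple[OF x0]]
  have "eventually (\<lambda>s. f s \<noteq> 0) (at_left x)"
    using left by (rule eventually_mono) (use simple[OF x0] in \<open>auto simp: sgn_0_0\<close>)
  moreover have "eventually (\<lambda>s. f s \<noteq> 0) (at_right x)"
    using right by (rule eventually_mono) (use simple[OF x0] in \<open>auto simp: sgn_0_0\<close>)
  ultimately have "eventually (\<lambda>s. f s \<noteq> 0) (at x)" by (simp add: eventually_at_split)
  then have "eventually (\<lambda>s. s \<notin> {t\<in>{a..b}. f t = 0}) (at x)" by (rule eventually_mono) simp
  then show False using x by (simp only: islimpt_iff_eventually not_True_eq_False)
qed

lemma no_zero_imp_sgn_eq:
  fixes f :: "real \<Rightarrow> real"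
  assumes cont: "continuous_on {a..b} f" and ab: "a \<le> b" and nz: "\<And>s. s \<in> {a..b} \<Longrightarrow> f s \<noteq> 0"
  shows "sgn (f a) = sgn (f b)"
proof (rule ccontr)
  assume "sgn (f a) \<noteq> sgn (f b)"
  then have "f a \<le> 0 \<and> 0 \<le> f b \<or> f b \<le> 0 \<and> 0 \<le> f a"
    using nz[of a] nz[of b] ab by (auto simp: sgn_real_def split: if_splits)
  then show False
    using IVT'[of f a 0 b] IVT2'[of f b 0 a] cont ab nz by force
qed

text \<open>Between the two zeros \<open>f\<close> keeps the sign that it takes on right after \<open>x\<close>, which is that of
  \<open>f' x\<close>, and which is opposite to \<open>f' y\<close> right before \<open>y\<close>.\<close>

lemma consecutive_simple_zeros:
  fixes f :: "real \<Rightarrow> real"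
  assumes der: "\<And>t. (f has_real_derivative f' t) (at t)" and simple: "\<And>t. f t = 0 \<Longrightarrow> f' t \<noteq> 0"
    and zeros: "f x = 0" "f y = 0" "x < y" and nz: "\<And>s. x < s \<Longrightarrow> s < y \<Longrightarrow> f s \<noteq> 0"
  shows "sgn (f' x) = - sgn (f' y)"
proof -
  obtain r where r: "x < r" "\<And>s. x < s \<Longrightarrow> s < r \<Longrightarrow> sgn (f s) = sgn (f' x)"
    using simple_zero_sign_right[OF der zeros(1) simple[OF zeros(1)]]
    by (auto simp: eventually_at_right_field)
  obtain l where l: "l < y" "\<And>s. l < s \<Longrightarrow> s < y \<Longrightarrow> sgn (f s) = - sgn (f' y)"
    using simple_zero_sign_left[OF der zeros(2) simple[OF zeros(2)]]
    by (auto simp: eventually_at_left_field)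
  obtain a where a: "x < a" "a < min r y" using dense[of x "min r y"] r zeros by auto
  obtain b where b: "max l a < b" "b < y" using dense[of "max l a" y] l a by auto
  have "continuous_on {a..b} f"
    using der by (meson DERIV_isCont continuous_at_imp_continuous_on)
  then have "sgn (f a) = sgn (f b)"
    by (rule no_zero_imp_sgn_eq) (use a b nz in auto)
  then show ?thesis using r(2)[of a] l(2)[of b] a b by simp
qed

lemma not_in_strictly_sorted_gap:
  fixes xs :: "'a::linorder list"
  assumes sorted: "sorted_wrt (<) xs" and i: "Suc i < length xs" and r: "xs ! i < r" "r < xs ! Suc i"
  shows "r \<notin> set xs"
proof
  assume "r \<in> set xs"
  then obtain j where j: "j < length xs" "xs ! j = r" by (auto simp: in_set_conv_nth)
  consider "j < i" | "j = i" | "j = Suc i" | "Suc i < j" by linarith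
  then show False
  proof cases
    case 1
    then show False using sorted_wrt_nth_less[OF sorted 1] i j r by (auto dest: order_less_trans)
  next
    case 4
    then show False using sorted_wrt_nth_less[OF sorted 4 j(1)] j r by (auto dest: order_less_trans)
  qed (use j r in auto)
qed

lemma alternating_sum_along_zeros:
  fixes f g :: "real \<Rightarrow> real"
  assumes der: "\<And>t. (f has_real_derivative f' t) (at t)" and simple: "\<And>t. f t = 0 \<Longrightarrow> f' t \<noteq> 0"
    and fin: "finite {t\<in>{a..<b}. f t = 0}" (is "finite ?Z")
  shows "\<bar>alternating_sum (map g (sorted_list_of_set {t\<in>{a..<b}. f t = 0}))\<bar> =
    \<bar>\<Sum>t\<in>{t\<in>{a..<b}. f t = 0}. sgn (f' t) * g t\<bar>"
proof (cases "sorted_list_of_set ?Z")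
  case Nil
  then have "?Z = {}" using fin by (metis set_empty2 set_sorted_list_of_set)
  then show ?thesis unfolding Nil by (simp only: list.map alternating_sum.simps sum.empty)
next
  case (Cons x xs)
  let ?xs = "sorted_list_of_set ?Z"
  have set: "set ?xs = ?Z" using fin by simp
  have sorted: "sorted_wrt (<) ?xs" by simp
  have succ: "successively (\<lambda>s t. sgn (f' s) = - sgn (f' t)) ?xs"
    unfolding successively_conv_nth
  proof (intro allI impI)
    fix i assume i: "Suc i < length ?xs"
    let ?s = "?xs ! i" and ?t = "?xs ! Suc i"
    have "?s \<in> set ?xs" "?t \<in> set ?xs" using i by (auto intro: nth_mem simp del: set_sorted_list_of_set)
    then have st: "?s \<in> ?Z" "?t \<in> ?Z" unfolding set by auto
    have lt: "?s < ?t" using sorted_wrt_nth_less[OF sorted _ i] by simp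
    show "sgn (f' ?s) = - sgn (f' ?t)"
    proof (rule consecutive_simple_zeros[OF der simple _ _ lt])
      fix r assume r: "?s < r" "r < ?t"
      show "f r \<noteq> 0"
      proof
        assume "f r = 0"
        then have "r \<in> set ?xs" unfolding set using r st by auto
        then show False using not_in_strictly_sorted_gap[OF sorted i r] by blast
      qed
    qed (use st in auto)
  qed
  have unit: "\<bar>sgn (f' t)\<bar> = 1" if "t \<in> set ?xs" for t
    using that simple[of t] unfolding set by (auto simp: abs_sgn_eq)
  have "alternating_sum (map g ?xs) = sgn (f' x) * (\<Sum>t\<leftarrow>?xs. sgn (f' t) * g t)"
    using alternating_sum_alternating_signs[of "\<lambda>t. sgn (f' t)" x xs g] succ unit
    unfolding Cons by blast
  also have "(\<Sum>t\<leftarrow>?xs. sgn (f' t) * g t) = (\<Sum>t\<in>?Z. sgn (f' t) * g t)"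
    using set by (subst sum_list_distinct_conv_sum_set) auto
  finally show ?thesis using unit[of x] unfolding Cons by (simp add: abs_mult)
qed

text \<open>Every zero is an upward or a downward crossing, and over a period there are equally many of each.\<close>

lemma even_card_simple_zeros:
  fixes A :: "real \<Rightarrow> real"
  assumes der: "\<And>t. (A has_real_derivative A' t) (at t)" and per: "periodic1 A"
    and simple: "\<And>t. A t = 0 \<Longrightarrow> A' t \<noteq> 0"
  shows "even (card {t\<in>{0..<1}. A t = 0})"
proof -
  have cont: "continuous_on UNIV A"
    using der by (meson DERIV_isCont continuous_at_imp_continuous_on)
  have "finite {t\<in>{0..1}. A t = 0}" by (rule finite_simple_zeros[OF der]) (use simple in blast)
  then have fin: "finite {t\<in>{0..<1}. A t = 0}" by (rule finite_subset[rotated]) auto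
  let ?U = "{t\<in>{0..<1}. crosses_up A t}" and ?D = "{t\<in>{0..<1}. crosses_down A t}"
  have iff: "A t = 0 \<longleftrightarrow> crosses_up A t \<or> crosses_down A t" for t
    using simple_zero_crosses_iff[OF der _ simple, of t] simple[of t] crosses_up_zero[of A t]
      crosses_down_zero[of A t] by (metis linorder_neqE_linordered_idom)
  have "card ?U = card ?D"
    by (rule periodic_crossings_balance[OF cont per]) (use fin in \<open>simp add: iff\<close>)
  moreover have "{t\<in>{0..<1}. A t = 0} = ?U \<union> ?D" using iff by blast
  moreover have "card (?U \<union> ?D) = card ?U + card ?D"
    using not_crosses_up_and_down[of A]
    by (intro card_Un_disjoint finite_subset[OF _ fin]) (auto simp: iff)
  ultimately show ?thesis by simp
qed

section \<open>Zero-crossings of a product\<close>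

text \<open>A crossing described through the whole zero plateau \<open>{q..t}\<close> that ends at \<open>t\<close>. In contrast to
  \<open>crosses_up\<close>, which refers to a point \<open>p < t\<close> that may be far away, this depends only on the
  signs of \<open>f\<close> near the plateau, so it survives multiplication by a function without zeros there.\<close>

definition crosses_up_from :: "(real \<Rightarrow> real) \<Rightarrow> real \<Rightarrow> real \<Rightarrow> bool" where
  "crosses_up_from f q t \<longleftrightarrow> q \<le> t \<and> (\<forall>s\<in>{q..t}. f s = 0) \<and>
     (\<forall>\<^sub>F s in at_left q. f s \<le> 0) \<and> (\<exists>\<^sub>F s in at_left q. f s < 0) \<and> (\<exists>\<^sub>F s in at_right t. f s > 0)"

lemma crosses_up_iff_from:
  assumes cont: "continuous_on UNIV f"
  shows "crosses_up f t \<longleftrightarrow> (\<exists>q. crosses_up_from f q t)"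
proof
  assume *: "crosses_up f t"
  then obtain p where p: "p < t" "f p < 0" "\<And>s. s \<in> {p..t} \<Longrightarrow> f s \<le> 0"
    unfolding crosses_up_def by blast
  have t0: "f t = 0" using * by (simp add: crosses_up_def)
  \<comment> \<open>The plateau begins at the supremum of the points before \<open>t\<close> where \<open>f\<close> is negative.\<close>
  define N where "N = {s\<in>{p..t}. f s < 0}"
  define q where "q = Sup N"
  have pN: "p \<in> N" using p by (simp add: N_def)
  have bdd: "bdd_above N" unfolding N_def by (rule bdd_aboveI[of _ t]) auto
  have pq: "p \<le> q" unfolding q_def by (rule cSup_upper[OF pN bdd])
  have qt: "q \<le> t" unfolding q_def using pN by (intro cSup_least) (auto simp: N_def)
  have zero: "f s = 0" if "q < s" "s \<le> t" for s
  proof (rule ccontr)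
    assume "f s \<noteq> 0"
    then have "s \<in> N" using p(3)[of s] that pq by (auto simp: N_def)
    from cSup_upper[OF this bdd] that show False unfolding q_def by simp
  qed
  have q0: "f q = 0"
  proof (cases "q = t")
    case False
    have "\<not> f q < 0"
    proof
      assume "f q < 0"
      then have "eventually (\<lambda>s. f s < 0) (at q)"
        using cont by (metis UNIV_I continuous_on_def order_tendstoD(2))
      then have "eventually (\<lambda>s. f s < 0) (at_right q)" by (simp add: eventually_at_split)
      then obtain e where e: "e > q" "\<And>y. q < y \<Longrightarrow> y < e \<Longrightarrow> f y < 0"
        by (auto simp: eventually_at_right_field)
      obtain s where "q < s" "s < min e t" using dense[of q "min e t"] e(1) qt False by auto
      then show False using e(2)[of s] zero[of s] by simp
    qed
    then show ?thesis using p(3)[of q] pq qt by simp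
  qed (use t0 in simp)
  have pq': "p < q" using pq q0 p(2) by (cases "p = q") auto
  then have "\<forall>\<^sub>F s in at_left q. s \<in> {p<..<q}" by (rule eventually_at_left_real)
  then have "\<forall>\<^sub>F s in at_left q. f s \<le> 0"
    by (rule eventually_mono) (use p(3) qt in auto)
  moreover have "\<exists>\<^sub>F s in at_left q. f s < 0"
  proof (rule ccontr)
    assume "\<not> (\<exists>\<^sub>F s in at_left q. f s < 0)"
    then obtain e where e: "e < q" "\<And>y. e < y \<Longrightarrow> y < q \<Longrightarrow> \<not> f y < 0"
      by (auto simp: frequently_def eventually_at_left_field)
    obtain s where s: "s \<in> N" "e < s"
      using less_cSupD[of N e] pN e(1) unfolding q_def by blast
    have "s \<le> q" unfolding q_def by (rule cSup_upper[OF s(1) bdd])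
    then show False using e(2)[of s] s q0 by (cases "s = q") (auto simp: N_def)
  qed
  moreover have "\<forall>s\<in>{q..t}. f s = 0" using zero q0 by (auto simp: order_le_less)
  ultimately have "crosses_up_from f q t"
    using * qt by (simp add: crosses_up_from_def crosses_up_def)
  then show "\<exists>q. crosses_up_from f q t" ..
next
  assume "\<exists>q. crosses_up_from f q t"
  then obtain q where q: "crosses_up_from f q t" ..
  then obtain r where r: "r < q" "\<And>y. r < y \<Longrightarrow> y < q \<Longrightarrow> f y \<le> 0"
    by (auto simp: crosses_up_from_def eventually_at_left_field)
  have "\<exists>\<^sub>F s in at_left q. f s < 0 \<and> s \<in> {r<..<q}"
    using q r(1) by (intro frequently_eventually_frequently eventually_at_left_real)
      (auto simp: crosses_up_from_def)
  then obtain p where p: "f p < 0" "r < p" "p < q" by (auto dest: frequently_ex)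
  have "f s \<le> 0" if "s \<in> {p..t}" for s
    using q r(2)[of s] p that unfolding crosses_up_from_def by (cases "s < q") auto
  moreover have "p < t" "f t = 0" "\<exists>\<^sub>F s in at_right t. f s > 0"
    using q p(3) by (auto simp: crosses_up_from_def)
  ultimately show "crosses_up f t" using p(1) unfolding crosses_up_def by blast
qed

lemma crosses_up_from_transfer:
  assumes "crosses_up_from f q t" "open U" "{q..t} \<subseteq> U" "\<And>s. s \<in> U \<Longrightarrow> sgn (h s) = sgn (f s)"
  shows "crosses_up_from h q t"
proof -
  have qt: "q \<le> t" using assms(1) by (simp add: crosses_up_from_def)
  have eq: "h s = 0 \<longleftrightarrow> f s = 0" "h s > 0 \<longleftrightarrow> f s > 0" "h s < 0 \<longleftrightarrow> f s < 0" "h s \<le> 0 \<longleftrightarrow> f s \<le> 0"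
    if "s \<in> U" for s
    using assms(4)[OF that] by (auto simp: sgn_real_def split: if_splits)
  have "eventually (\<lambda>s. s \<in> U) (at q)" "eventually (\<lambda>s. s \<in> U) (at t)"
    using assms(2,3) qt by (auto intro!: eventually_at_in_open')
  then have ev: "eventually (\<lambda>s. s \<in> U) (at_left q)" "eventually (\<lambda>s. s \<in> U) (at_right t)"
    by (auto simp: eventually_at_split)
  note f = assms(1)[unfolded crosses_up_from_def]
  have "\<forall>\<^sub>F s in at_left q. h s \<le> 0"
    using ev(1) f by (auto elim: eventually_elim2 simp: eq)
  moreover have "\<exists>\<^sub>F s in at_left q. f s < 0 \<and> s \<in> U"
    using f ev(1) by (intro frequently_eventually_frequently) auto
  then have "\<exists>\<^sub>F s in at_left q. h s < 0" by (rule frequently_elim1) (simp add: eq)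
  moreover have "\<exists>\<^sub>F s in at_right t. f s > 0 \<and> s \<in> U"
    using f ev(2) by (intro frequently_eventually_frequently) auto
  then have "\<exists>\<^sub>F s in at_right t. h s > 0" by (rule frequently_elim1) (simp add: eq)
  moreover have "\<forall>s\<in>{q..t}. h s = 0" using f assms(3) eq(1) by blast
  ultimately show ?thesis using qt by (simp add: crosses_up_from_def)
qed

text \<open>On the plateau of zeros of \<open>A * K\<close> that ends at \<open>t\<close>, the factor \<open>A\<close> has no zero, since right
  after a zero of \<open>A\<close> the product does not vanish. So \<open>A\<close> has constant sign near the plateau, and
  there \<open>K\<close> changes sign together with the product.\<close>

lemma product_crosses_up_imp:
  fixes A K :: "real \<Rightarrow> real"
  assumes contA: "continuous_on UNIV A" and contK: "continuous_on UNIV K"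
    and isolated: "\<And>s. A s = 0 \<Longrightarrow> K s \<noteq> 0 \<and> eventually (\<lambda>r. A r \<noteq> 0) (at_right s)"
    and up: "crosses_up (\<lambda>s. A s * K s) t" and At: "A t \<noteq> 0"
  shows "crosses_up K t \<or> crosses_down K t"
proof -
  have cont: "continuous_on UNIV (\<lambda>s. A s * K s)" by (intro continuous_intros contA contK)
  obtain q where q: "crosses_up_from (\<lambda>s. A s * K s) q t"
    using up crosses_up_iff_from[OF cont] by blast
  then have qt: "q \<le> t" and zero: "\<And>s. s \<in> {q..t} \<Longrightarrow> A s * K s = 0"
    by (auto simp: crosses_up_from_def)
  have nz: "A s \<noteq> 0" if s: "s \<in> {q..t}" for s
  proof
    assume As: "A s = 0"
    then have "s < t" using At s by (cases "s = t") auto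
    have "isCont K s" using contK by (simp add: continuous_on_eq_continuous_at)
    then have "eventually (\<lambda>r. K r \<noteq> 0) (at s)"
      using isolated[OF As] by (intro tendsto_imp_eventually_ne[where c = "K s"]) (auto simp: isCont_def)
    then have "eventually (\<lambda>r. K r \<noteq> 0) (at_right s)" by (simp add: eventually_at_split)
    moreover have "eventually (\<lambda>r. r \<in> {s<..<t}) (at_right s)"
      by (rule eventually_at_right_real[OF \<open>s < t\<close>])
    moreover have "eventually (\<lambda>r. A r \<noteq> 0) (at_right s)" using isolated[OF As] by simp
    ultimately have "eventually (\<lambda>r. False) (at_right s)"
      by eventually_elim (use zero s in \<open>metis atLeastAtMost_iff greaterThanLessThan_iff less_imp_le mult_eq_0_iff order_trans\<close>)
    then show False by simp
  qed
  have sgnA: "sgn (A s) = sgn (A t)" if "s \<in> {q..t}" for s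
    using that nz by (intro no_zero_imp_sgn_eq continuous_on_subset[OF contA]) auto
  show ?thesis
  proof (cases "A t > 0")
    case True
    have "crosses_up_from K q t"
    proof (rule crosses_up_from_transfer[OF q, where U = "{s. A s > 0}"])
      show "open {s. A s > 0}" by (intro open_Collect_less contA continuous_intros)
      show "{q..t} \<subseteq> {s. A s > 0}" using sgnA True by (auto simp: sgn_1_pos)
    qed (auto simp: sgn_mult)
    then show ?thesis using crosses_up_iff_from[OF contK] by blast
  next
    case False
    then have neg: "A t < 0" using At by simp
    have "crosses_up_from (\<lambda>s. - K s) q t"
    proof (rule crosses_up_from_transfer[OF q, where U = "{s. A s < 0}"])
      show "open {s. A s < 0}" by (intro open_Collect_less contA continuous_intros)
      show "{q..t} \<subseteq> {s. A s < 0}" using sgnA neg by (auto simp: sgn_1_neg)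
    qed (auto simp: sgn_mult sgn_minus)
    moreover have "continuous_on UNIV (\<lambda>s. - K s)" by (intro continuous_intros contK)
    ultimately show ?thesis using crosses_up_iff_from crosses_down_uminus by blast
  qed
qed

text \<open>With \<open>A\<close> and \<open>K\<close> in the roles of \<open>\<alpha>\<close> and \<open>\<kappa>\<close>, the two sets on the left are the flips and
  the flops. The crossings of \<open>A * K\<close> balance over a period; those that are neither flips nor flops
  are the zeros of \<open>A\<close>, where the derivative of \<open>A * K\<close> is \<open>A' * K\<close>.\<close>

lemma flips_minus_flops:
  fixes A K :: "real \<Rightarrow> real"
  assumes derA: "\<And>t. (A has_real_derivative A' t) (at t)" and derK: "\<And>t. (K has_real_derivative K' t) (at t)"
    and per: "periodic1 A" "periodic1 K"
    and cusp: "\<And>t. A t = 0 \<Longrightarrow> A' t \<noteq> 0 \<and> K t \<noteq> 0"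
    and fin: "finite {t\<in>{0..<1}. crosses_up K t \<or> crosses_down K t}" (is "finite ?I")
  shows "real (card {t\<in>{0..<1}. (crosses_up K t \<or> crosses_down K t) \<and> crosses_up (\<lambda>s. A s * K s) t})
    - real (card {t\<in>{0..<1}. (crosses_up K t \<or> crosses_down K t) \<and> crosses_down (\<lambda>s. A s * K s) t})
    = - (\<Sum>t\<in>{t\<in>{0..<1}. A t = 0}. sgn (A' t) * sgn (K t))"
    (is "real (card ?flip) - real (card ?flop) = - (\<Sum>t\<in>?Z. _)")
proof -
  let ?g = "\<lambda>s. A s * K s"
  have contA: "continuous_on UNIV A" and contK: "continuous_on UNIV K"
    using derA derK by (meson DERIV_isCont continuous_at_imp_continuous_on)+
  have contg: "continuous_on UNIV ?g" by (intro continuous_intros contA contK)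
  have perg: "periodic1 ?g" using per by (simp add: periodic1_def)
  have "finite {t\<in>{0..1}. A t = 0}" by (rule finite_simple_zeros[OF derA]) (use cusp in blast)
  then have finZ: "finite ?Z" by (rule finite_subset[rotated]) auto
  have isolated: "eventually (\<lambda>r. A r \<noteq> 0) (at_right s)" if "A s = 0" for s
  proof -
    have "eventually (\<lambda>r. sgn (A r) = sgn (A' s)) (at_right s)"
      using cusp[OF that] by (intro simple_zero_sign_right[OF derA that]) simp
    then show ?thesis by (rule eventually_mono) (use cusp[OF that] in \<open>auto simp: sgn_0_0\<close>)
  qed
  have derg: "(?g has_real_derivative A' t * K t) (at t)" if "A t = 0" for t
    using DERIV_mult[OF derA derK, of t] that by simp
  have at_cusp: "crosses_up ?g t \<longleftrightarrow> A' t * K t > 0" "crosses_down ?g t \<longleftrightarrow> A' t * K t < 0"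
    if "A t = 0" for t
    using simple_zero_crosses_iff[OF derg[OF that]] cusp[OF that] that by auto
  have up_K: "crosses_up K t \<or> crosses_down K t" if "crosses_up ?g t" "A t \<noteq> 0" for t
    using product_crosses_up_imp[OF contA contK _ that] cusp isolated by blast
  have down_K: "crosses_up K t \<or> crosses_down K t" if "crosses_down ?g t" "A t \<noteq> 0" for t
  proof -
    have contmK: "continuous_on UNIV (\<lambda>s. - K s)" by (intro continuous_intros contK)
    have "crosses_up (\<lambda>s. A s * - K s) t" using that(1) by (simp add: crosses_down_uminus)
    from product_crosses_up_imp[OF contA contmK _ this that(2)] cusp isolated
    show ?thesis by (auto simp: crosses_down_uminus[of K] crosses_up_uminus[of K])
  qed
  have K_imp: "A t \<noteq> 0" if "crosses_up K t \<or> crosses_down K t" for t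
    using that cusp[of t] crosses_up_zero crosses_down_zero by blast
  let ?U = "{t\<in>?Z. A' t * K t > 0}" and ?D = "{t\<in>?Z. A' t * K t < 0}"
  have up: "{t\<in>{0..<1}. crosses_up ?g t} = ?flip \<union> ?U"
    using up_K at_cusp(1) by blast
  have down: "{t\<in>{0..<1}. crosses_down ?g t} = ?flop \<union> ?D"
    using down_K at_cusp(2) by blast
  have "?flip \<subseteq> ?I" "?flop \<subseteq> ?I" "?U \<subseteq> ?Z" "?D \<subseteq> ?Z" by auto
  then have fin': "finite ?flip" "finite ?flop" "finite ?U" "finite ?D"
    using finite_subset fin finZ by blast+
  have "finite {t\<in>{0..<1}. crosses_up ?g t \<or> crosses_down ?g t}"
  proof (rule finite_subset)
    show "{t\<in>{0..<1}. crosses_up ?g t \<or> crosses_down ?g t} \<subseteq>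
      {t\<in>{0..<1}. crosses_up ?g t} \<union> {t\<in>{0..<1}. crosses_down ?g t}" by blast
    show "finite ({t\<in>{0..<1}. crosses_up ?g t} \<union> {t\<in>{0..<1}. crosses_down ?g t})"
      unfolding up down using fin' by simp
  qed
  from periodic_crossings_balance[OF contg perg this]
  have "card (?flip \<union> ?U) = card (?flop \<union> ?D)" unfolding up down .
  moreover have "card (?flip \<union> ?U) = card ?flip + card ?U"
    using fin' K_imp by (intro card_Un_disjoint) blast+
  moreover have "card (?flop \<union> ?D) = card ?flop + card ?D"
    using fin' K_imp by (intro card_Un_disjoint) blast+
  moreover have "(\<Sum>t\<in>?Z. sgn (A' t) * sgn (K t)) = real (card ?U) - real (card ?D)"
  proof -
    have "(\<Sum>t\<in>?Z. sgn (A' t) * sgn (K t)) =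
      (\<Sum>t\<in>?Z. (if A' t * K t > 0 then 1 else 0) - (if A' t * K t < 0 then 1 else 0))"
      using cusp by (intro sum.cong) (auto simp: sgn_real_def zero_less_mult_iff mult_less_0_iff)
    also have "\<dots> = real (card ?U) - real (card ?D)"
      using finZ by (simp add: sum_subtractf sum.If_cases Int_def)
    finally show ?thesis .
  qed
  ultimately show ?thesis by simp
qed

section \<open>Birkhoff orthogonality in a smooth normed plane\<close>

text \<open>A third vector outside the span would give three independent vectors in a plane.\<close>

lemma plane_spanned:
  fixes x y z :: "'a::real_normed_vector"
  assumes dim: "dim (UNIV :: 'a set) = 2" and x: "x \<noteq> 0" and y: "y \<notin> span {x}"
  shows "z \<in> span {x, y}"
proof (rule ccontr)
  assume z: "z \<notin> span {x, y}"
  obtain B :: "'a set" where B: "UNIV \<subseteq> span B" "card B = 2"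
    using basis_exists[of "UNIV :: 'a set"] dim by metis
  then have fB: "finite B" by (metis card.infinite zero_neq_numeral)
  have xy: "independent {y, x}" using x y by (simp add: independent_insert)
  then have "independent {z, y, x}" using z by (subst independent_insert) (auto simp: insert_commute)
  then have "card {z, y, x} \<le> 2" using independent_span_bound[OF fB] B by auto
  moreover have "y \<noteq> x" "z \<noteq> x" "z \<noteq> y" using y z by (auto intro: span_base)
  ultimately show False by simp
qed

lemma symplectic_bilinear: "symplectic_form \<omega> \<Longrightarrow> bilinear \<omega>"
  by (simp add: symplectic_form_def)

lemmas bilinear_simps = bilinear_ladd bilinear_radd bilinear_lsub bilinear_rsub
  bilinear_lmul bilinear_rmul bilinear_lzero bilinear_rzero bilinear_lneg bilinear_rneg

lemma symplectic_self: "symplectic_form \<omega> \<Longrightarrow> \<omega> x x = 0"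
  by (simp add: symplectic_form_def)

lemma symplectic_swap:
  assumes "symplectic_form \<omega>" shows "\<omega> y x = - \<omega> x y"
proof -
  have "\<omega> (x + y) (x + y) = \<omega> x x + \<omega> x y + \<omega> y x + \<omega> y y"
    by (simp add: bilinear_simps[OF symplectic_bilinear[OF assms]])
  then show ?thesis by (simp add: symplectic_self[OF assms])
qed

lemma symplectic_eq_0_imp_parallel:
  fixes x y :: "'a::real_normed_vector"
  assumes dim: "dim (UNIV :: 'a set) = 2" and \<omega>: "symplectic_form \<omega>" and "\<omega> x y = 0" "x \<noteq> 0"
  shows "\<exists>c. y = c *\<^sub>R x"
proof (rule ccontr)
  assume "\<not> ?thesis"
  then have y: "y \<notin> span {x}" by (auto simp: span_singleton)
  obtain z where z: "\<omega> x z \<noteq> 0" using \<omega> \<open>x \<noteq> 0\<close> unfolding symplectic_form_def by blast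
  have "z \<in> span {x, y}" by (rule plane_spanned[OF dim \<open>x \<noteq> 0\<close> y])
  then obtain k l where zk: "z - k *\<^sub>R x = l *\<^sub>R y"
    by (auto simp: span_insert span_singleton)
  have "\<omega> x z = \<omega> x (z - k *\<^sub>R x)"
    by (simp add: bilinear_simps[OF symplectic_bilinear[OF \<omega>]] symplectic_self[OF \<omega>])
  also have "\<dots> = 0"
    unfolding zk using \<open>\<omega> x y = 0\<close> by (simp add: bilinear_simps[OF symplectic_bilinear[OF \<omega>]])
  finally show False using z by simp
qed

lemma symplectic_expansion:
  fixes v w x :: "'a::real_normed_vector"
  assumes dim: "dim (UNIV :: 'a set) = 2" and \<omega>: "symplectic_form \<omega>" and vw: "\<omega> v w \<noteq> 0"
  shows "x = (\<omega> x w / \<omega> v w) *\<^sub>R v + (\<omega> v x / \<omega> v w) *\<^sub>R w"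
proof -
  note simps = bilinear_simps[OF symplectic_bilinear[OF \<omega>]] symplectic_self[OF \<omega>]
  define d where "d = x - ((\<omega> x w / \<omega> v w) *\<^sub>R v + (\<omega> v x / \<omega> v w) *\<^sub>R w)"
  have "v \<noteq> 0" using vw by (auto simp: simps)
  moreover have "\<omega> v d = 0" using vw by (simp add: d_def simps)
  ultimately obtain c where c: "d = c *\<^sub>R v"
    using symplectic_eq_0_imp_parallel[OF dim \<omega>] by blast
  have "\<omega> d w = 0" using vw by (simp add: d_def simps)
  then have "c = 0" using vw by (simp add: c simps)
  then have "d = 0" using c by simp
  then show ?thesis unfolding d_def by simp
qed

lemma birkhoff_orthogonal_scale:
  assumes "birkhoff_orthogonal v w" shows "birkhoff_orthogonal v (c *\<^sub>R w)"
  using assms unfolding birkhoff_orthogonal_def by simp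

lemma birkhoff_imp_symplectic_ne_0:
  fixes v w :: "'a::real_normed_vector"
  assumes dim: "dim (UNIV :: 'a set) = 2" and \<omega>: "symplectic_form \<omega>"
    and "birkhoff_orthogonal v w" "v \<noteq> 0" "w \<noteq> 0"
  shows "\<omega> v w \<noteq> 0"
proof
  assume "\<omega> v w = 0"
  then obtain c where c: "w = c *\<^sub>R v"
    using symplectic_eq_0_imp_parallel[OF dim \<omega>] \<open>v \<noteq> 0\<close> by blast
  with \<open>w \<noteq> 0\<close> have "v + (- 1 / c) *\<^sub>R w = 0" by auto
  then have "norm v \<le> 0" using assms(3) unfolding birkhoff_orthogonal_def by (metis norm_zero)
  with \<open>v \<noteq> 0\<close> show False by simp
qed

text \<open>Writing \<open>x = a v + b w\<close>, Birkhoff orthogonality says \<open>\<bar>a\<bar> * norm v \<le> norm x\<close>, and \<open>a\<close> is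
  \<open>\<omega> x w / \<omega> v w\<close>. So \<open>\<omega> _ w\<close> is a bounded functional as soon as some \<open>v \<noteq> 0\<close> is orthogonal to \<open>w\<close>.\<close>

lemma birkhoff_symplectic_bound:
  fixes v w x :: "'a::real_normed_vector"
  assumes dim: "dim (UNIV :: 'a set) = 2" and \<omega>: "symplectic_form \<omega>"
    and vw: "birkhoff_orthogonal v w"
  shows "\<bar>\<omega> x w\<bar> * norm v \<le> \<bar>\<omega> v w\<bar> * norm x"
proof (cases "\<omega> v w = 0 \<or> \<omega> x w = 0")
  case True
  show ?thesis
  proof (cases "\<omega> x w = 0")
    case False
    with True have "v = 0 \<or> w = 0" using birkhoff_imp_symplectic_ne_0[OF dim \<omega> vw] by blast
    then show ?thesis using False by (auto simp: bilinear_simps[OF symplectic_bilinear[OF \<omega>]])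
  qed simp
next
  case False
  define a b where "a = \<omega> x w / \<omega> v w" and "b = \<omega> v x / \<omega> v w"
  have x: "x = a *\<^sub>R v + b *\<^sub>R w"
    using symplectic_expansion[OF dim \<omega>, of v w x] False by (simp add: a_def b_def)
  have "a \<noteq> 0" using False by (simp add: a_def)
  have "\<bar>a\<bar> * norm v \<le> \<bar>a\<bar> * norm (v + (b / a) *\<^sub>R w)"
    using vw by (intro mult_left_mono) (auto simp: birkhoff_orthogonal_def)
  also have "\<dots> = norm (a *\<^sub>R (v + (b / a) *\<^sub>R w))" by simp
  also have "a *\<^sub>R (v + (b / a) *\<^sub>R w) = x" using \<open>a \<noteq> 0\<close> x by (simp add: scaleR_add_right)
  finally have "\<bar>a\<bar> * norm v \<le> norm x" .
  then show ?thesis using False by (simp add: a_def field_simps)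
qed

text \<open>The convex function \<open>t \<mapsto> norm (c s + t d)\<close> differs from the constant \<open>norm (c (s + t)) = 1\<close> by
  \<open>o(t)\<close>, so it has derivative \<open>0\<close> at \<open>0\<close>, and a convex function is minimal where its derivative
  vanishes.\<close>

lemma tangent_imp_birkhoff:
  fixes c :: "real \<Rightarrow> 'a::real_normed_vector"
  assumes der: "(c has_vector_derivative d) (at s)" and unit: "\<And>s. norm (c s) = 1"
  shows "birkhoff_orthogonal (c s) d"
  unfolding birkhoff_orthogonal_def
proof
  fix t :: real
  have lim: "((\<lambda>h. norm (c (s + h * t) - c s - (h * t) *\<^sub>R d) / \<bar>h\<bar>) \<longlongrightarrow> 0) (at_right 0)"
  proof (cases "t = 0")
    case False
    have *: "((\<lambda>x. norm (c (s + x) - c s - x *\<^sub>R d) / norm x) \<longlongrightarrow> 0) (at 0)"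
      using der by (auto simp: has_vector_derivative_def has_derivative_at)
    have "((\<lambda>h. h * t) \<longlongrightarrow> 0) (at_right 0)" by (auto intro!: tendsto_eq_intros)
    moreover have "eventually (\<lambda>h. h * t \<noteq> 0) (at_right 0)"
      using False by (auto simp: eventually_at_filter)
    ultimately have "filterlim (\<lambda>h. h * t) (at 0) (at_right 0)" by (simp add: filterlim_at)
    from filterlim_compose[OF * this]
    have "((\<lambda>h. \<bar>t\<bar> * (norm (c (s + h * t) - c s - (h * t) *\<^sub>R d) / norm (h * t))) \<longlongrightarrow> \<bar>t\<bar> * 0) (at_right 0)"
      by (intro tendsto_intros)
    then show ?thesis using False by (simp add: abs_mult)
  qed simp
  have "eventually (\<lambda>h. h \<in> {0<..<1}) (at_right (0::real))" by (rule eventually_at_right_real) simp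
  then have "eventually (\<lambda>h. 1 - norm (c s + t *\<^sub>R d) \<le> norm (c (s + h * t) - c s - (h * t) *\<^sub>R d) / \<bar>h\<bar>)
    (at_right 0)"
  proof (rule eventually_mono)
    fix h :: real assume h: "h \<in> {0<..<1}"
    \<comment> \<open>\<open>c s + h * t * d\<close> is a convex combination of \<open>c s\<close> and \<open>c s + t * d\<close>.\<close>
    have "1 = norm (c (s + h * t))" by (simp add: unit)
    also have "\<dots> = norm ((c (s + h * t) - c s - (h * t) *\<^sub>R d) + ((1 - h) *\<^sub>R c s + h *\<^sub>R (c s + t *\<^sub>R d)))"
      by (simp add: algebra_simps)
    also have "\<dots> \<le> norm (c (s + h * t) - c s - (h * t) *\<^sub>R d) + norm ((1 - h) *\<^sub>R c s + h *\<^sub>R (c s + t *\<^sub>R d))"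
      by (rule norm_triangle_ineq)
    also have "norm ((1 - h) *\<^sub>R c s + h *\<^sub>R (c s + t *\<^sub>R d)) \<le> (1 - h) * 1 + h * norm (c s + t *\<^sub>R d)"
      using h by (intro order_trans[OF norm_triangle_ineq]) (simp add: unit)
    finally have "h * (1 - norm (c s + t *\<^sub>R d)) \<le> norm (c (s + h * t) - c s - (h * t) *\<^sub>R d)"
      by (simp add: algebra_simps)
    then show "1 - norm (c s + t *\<^sub>R d) \<le> norm (c (s + h * t) - c s - (h * t) *\<^sub>R d) / \<bar>h\<bar>"
      using h by (simp add: pos_le_divide_eq mult.commute)
  qed
  then have "1 - norm (c s + t *\<^sub>R d) \<le> 0"
    using lim by (intro tendsto_lowerbound[OF lim]) auto
  then show "norm (c s) \<le> norm (c s + t *\<^sub>R d)" by (simp add: unit)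
qed

lemma birkhoff_limit:
  fixes u w :: "real \<Rightarrow> 'a::real_normed_vector"
  assumes u: "(u \<longlongrightarrow> v) F" and w: "(w \<longlongrightarrow> x) F" and F: "F \<noteq> bot"
    and ev: "eventually (\<lambda>s. birkhoff_orthogonal (u s) (w s)) F"
  shows "birkhoff_orthogonal v x"
  unfolding birkhoff_orthogonal_def
proof
  fix t :: real
  have "((\<lambda>s. norm (u s)) \<longlongrightarrow> norm v) F" "((\<lambda>s. norm (u s + t *\<^sub>R w s)) \<longlongrightarrow> norm (v + t *\<^sub>R x)) F"
    by (intro tendsto_intros u w)+
  moreover have "eventually (\<lambda>s. norm (u s) \<le> norm (u s + t *\<^sub>R w s)) F"
    using ev by (rule eventually_mono) (auto simp: birkhoff_orthogonal_def)
  ultimately show "norm v \<le> norm (v + t *\<^sub>R x)" using F by (intro tendsto_le[of F])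
qed

text \<open>The converse of \<open>tangent_imp_birkhoff\<close> in a plane: the functional \<open>\<omega> _ w / \<omega> (c s) w\<close> has norm
  at most \<open>1\<close> and takes the value \<open>1\<close> at \<open>c s\<close>, so along \<open>c\<close> it has a maximum at \<open>s\<close>. Its
  derivative \<open>\<omega> d w / \<omega> (c s) w\<close> must vanish.\<close>

lemma birkhoff_imp_tangent:
  fixes c :: "real \<Rightarrow> 'a::real_normed_vector"
  assumes dim: "dim (UNIV :: 'a set) = 2" and \<omega>: "symplectic_form \<omega>"
    and der: "(c has_vector_derivative d) (at s)" and unit: "\<And>s. norm (c s) = 1"
    and w: "birkhoff_orthogonal (c s) w"
  shows "\<omega> d w = 0"
proof (cases "\<omega> (c s) w = 0")
  case True
  moreover have "c s \<noteq> 0" using unit[of s] by auto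
  ultimately have "w = 0" using birkhoff_imp_symplectic_ne_0[OF dim \<omega> w] by blast
  then show ?thesis by (simp add: bilinear_simps[OF symplectic_bilinear[OF \<omega>]])
next
  case False
  note simps = bilinear_simps[OF symplectic_bilinear[OF \<omega>]]
  have bound: "\<bar>\<omega> x w\<bar> \<le> norm x * \<bar>\<omega> (c s) w\<bar>" for x
    using birkhoff_symplectic_bound[OF dim \<omega> w, of x] by (simp add: unit mult.commute)
  have "bounded_linear (\<lambda>x. \<omega> x w)"
    by (rule bounded_linear_intro[where K = "\<bar>\<omega> (c s) w\<bar>"]) (use bound in \<open>auto simp: simps\<close>)
  from bounded_linear.has_vector_derivative[OF this der]
  have "((\<lambda>r. \<omega> (c r) w / \<omega> (c s) w) has_real_derivative \<omega> d w / \<omega> (c s) w) (at s)"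
    by (intro DERIV_cdivide) (simp add: has_real_derivative_iff_has_vector_derivative)
  moreover have "\<omega> (c r) w / \<omega> (c s) w \<le> \<omega> (c s) w / \<omega> (c s) w" for r
    using bound[of "c r"] False by (cases "\<omega> (c s) w > 0") (auto simp: unit divide_simps)
  ultimately have "\<omega> d w / \<omega> (c s) w = 0"
    by (intro DERIV_local_max[of _ _ s 1]) auto
  then show ?thesis using False by simp
qed

text \<open>By \<open>birkhoff_symplectic_bound\<close> both \<open>\<omega> _ w1\<close> and \<open>\<omega> _ w2\<close> are bounded, and \<open>\<omega> x y\<close> is a
  polynomial in their values at \<open>x\<close> and \<open>y\<close>, because these values are the coordinates of a vector
  in the basis \<open>w1\<close>, \<open>w2\<close>.\<close>

lemma symplectic_bounded_bilinear:
  fixes \<omega> :: "'a::real_normed_vector \<Rightarrow> 'a \<Rightarrow> real"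
  assumes dim: "dim (UNIV :: 'a set) = 2" and \<omega>: "symplectic_form \<omega>"
    and v1: "birkhoff_orthogonal v1 w1" "norm v1 = 1" and v2: "birkhoff_orthogonal v2 w2" "norm v2 = 1"
    and w: "\<omega> w1 w2 \<noteq> 0"
  shows "bounded_bilinear \<omega>"
proof -
  note simps = bilinear_simps[OF symplectic_bilinear[OF \<omega>]]
  define D C1 C2 where "D = \<bar>\<omega> w1 w2\<bar>" and "C1 = \<bar>\<omega> v1 w1\<bar>" and "C2 = \<bar>\<omega> v2 w2\<bar>"
  have D: "D > 0" using w by (simp add: D_def)
  have b1: "\<bar>\<omega> x w1\<bar> \<le> C1 * norm x" for x
    using birkhoff_symplectic_bound[OF dim \<omega> v1(1), of x] by (simp add: v1 C1_def)
  have b2: "\<bar>\<omega> x w2\<bar> \<le> C2 * norm x" for x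
    using birkhoff_symplectic_bound[OF dim \<omega> v2(1), of x] by (simp add: v2 C2_def)
  have "norm (\<omega> x y) \<le> norm x * norm y * (2 * C1 * C2 / D)" for x y
  proof -
    have "\<omega> x y = \<omega> x ((\<omega> y w2 / \<omega> w1 w2) *\<^sub>R w1 + (\<omega> w1 y / \<omega> w1 w2) *\<^sub>R w2)"
      using symplectic_expansion[OF dim \<omega> w, of y] by simp
    also have "\<dots> = (\<omega> y w2 * \<omega> x w1 - \<omega> y w1 * \<omega> x w2) / \<omega> w1 w2"
      using symplectic_swap[OF \<omega>, of w1 y] by (simp add: simps diff_divide_distrib)
    finally have "\<bar>\<omega> x y\<bar> = \<bar>\<omega> y w2 * \<omega> x w1 - \<omega> y w1 * \<omega> x w2\<bar> / D"
      by (simp add: D_def abs_divide)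
    also have "\<dots> \<le> (\<bar>\<omega> y w2\<bar> * \<bar>\<omega> x w1\<bar> + \<bar>\<omega> y w1\<bar> * \<bar>\<omega> x w2\<bar>) / D"
      using D by (intro divide_right_mono order_trans[OF abs_triangle_ineq4]) (auto simp: abs_mult)
    also have "\<dots> \<le> ((C2 * norm y) * (C1 * norm x) + (C1 * norm y) * (C2 * norm x)) / D"
      using D by (intro divide_right_mono add_mono mult_mono b1 b2) (auto simp: C1_def C2_def)
    also have "\<dots> = norm x * norm y * (2 * C1 * C2 / D)" by (simp add: algebra_simps)
    finally show ?thesis by simp
  qed
  then show ?thesis
    by (intro bounded_bilinear.intro exI[of _ "2 * C1 * C2 / D"]) (auto simp: simps)
qed

lemma smooth_map_has_derivative:
  assumes "smooth_map f"
  shows "((vderiv ^^ n) f has_vector_derivative (vderiv ^^ Suc n) f t) (at t)"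
  using assms by (simp add: smooth_map_def vderiv_def vector_derivative_works)

lemma smooth_sphere_tangent:
  assumes "smooth_closed_curve (sphere (0::'a::real_normed_vector) 1)" "norm (v::'a) = 1"
  shows "\<exists>c s d. (c has_vector_derivative d) (at s) \<and> (\<forall>r. norm (c r) = 1) \<and> c s = v \<and> d \<noteq> (0::'a)"
proof -
  obtain c :: "real \<Rightarrow> 'a" where c: "smooth_map c" "\<And>t. vderiv c t \<noteq> 0" "range c = sphere 0 1"
    using assms(1) unfolding smooth_closed_curve_def by blast
  have "norm (c r) = 1" for r using c(3) by (metis dist_0_norm mem_sphere rangeI)
  moreover obtain s where "c s = v" using c(3) assms(2) by (metis dist_0_norm image_iff mem_sphere)
  moreover have "(c has_vector_derivative vderiv c s) (at s)"
    using smooth_map_has_derivative[OF c(1), of 0] by simp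
  ultimately show ?thesis using c(2) by blast
qed

text \<open>The two directions needed are obtained by taking a tangent \<open>w1\<close> at some point of the unit circle
  and then a tangent at the point in direction \<open>w1\<close>.\<close>

lemma smooth_plane_bounded_bilinear:
  fixes \<omega> :: "'a::real_normed_vector \<Rightarrow> 'a \<Rightarrow> real"
  assumes dim: "dim (UNIV :: 'a set) = 2" and smooth: "smooth_closed_curve (sphere (0::'a) 1)"
    and \<omega>: "symplectic_form \<omega>"
  shows "bounded_bilinear \<omega>"
proof -
  note simps = bilinear_simps[OF symplectic_bilinear[OF \<omega>]]
  obtain c :: "real \<Rightarrow> 'a" where "range c = sphere 0 1"
    using smooth unfolding smooth_closed_curve_def by blast
  then have "norm (c 0) = 1" by (metis dist_0_norm mem_sphere rangeI)
  from smooth_sphere_tangent[OF smooth this] obtain w1 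
    where w1: "birkhoff_orthogonal (c 0) w1" "w1 \<noteq> 0"
    using tangent_imp_birkhoff by metis
  define v2 where "v2 = w1 /\<^sub>R norm w1"
  have v2: "norm v2 = 1" using w1 by (simp add: v2_def)
  from smooth_sphere_tangent[OF smooth this] obtain w2
    where w2: "birkhoff_orthogonal v2 w2" "w2 \<noteq> 0"
    using tangent_imp_birkhoff by metis
  have "\<omega> v2 w2 \<noteq> 0"
    using v2 w2 by (intro birkhoff_imp_symplectic_ne_0[OF dim \<omega>]) auto
  then have "\<omega> w1 w2 \<noteq> 0" by (auto simp: v2_def simps)
  then show ?thesis
    by (rule symplectic_bounded_bilinear[OF dim \<omega> w1(1) \<open>norm (c 0) = 1\<close> w2(1) v2])
qed

text \<open>Both vectors are parallel to the tangent of the unit circle at \<open>v\<close>; this is where smoothness of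
  the norm enters.\<close>

lemma birkhoff_right_unique:
  fixes \<omega> :: "'a::real_normed_vector \<Rightarrow> 'a \<Rightarrow> real"
  assumes dim: "dim (UNIV :: 'a set) = 2" and smooth: "smooth_closed_curve (sphere (0::'a) 1)"
    and \<omega>: "symplectic_form \<omega>" and v: "norm (v::'a) = 1"
    and u: "birkhoff_orthogonal v u" and w: "birkhoff_orthogonal v w" "w \<noteq> 0"
  shows "\<exists>c. u = c *\<^sub>R w"
proof -
  obtain c s d where c: "(c has_vector_derivative d) (at s)" "\<And>r. norm (c r) = 1" "c s = v" "d \<noteq> 0"
    using smooth_sphere_tangent[OF smooth v] by blast
  have "\<omega> d u = 0" "\<omega> d w = 0"
    using birkhoff_imp_tangent[OF dim \<omega> c(1,2)] u w c(3) by auto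
  then obtain k l where "u = k *\<^sub>R d" "w = l *\<^sub>R d"
    using symplectic_eq_0_imp_parallel[OF dim \<omega>] c(4) by metis
  then show ?thesis using w(2) by (intro exI[of _ "k / l"]) auto
qed

lemma birkhoff_map_props:
  fixes \<omega> :: "'a::real_normed_vector \<Rightarrow> 'a \<Rightarrow> real"
  assumes dim: "dim (UNIV :: 'a set) = 2" and smooth: "smooth_closed_curve (sphere (0::'a) 1)"
    and \<omega>: "symplectic_form \<omega>" and v: "norm (v::'a) = 1"
  shows "birkhoff_orthogonal v (birkhoff_map \<omega> v)" "\<omega> v (birkhoff_map \<omega> v) > 0"
proof -
  note simps = bilinear_simps[OF symplectic_bilinear[OF \<omega>]]
  let ?P = "\<lambda>w. w \<in> sphere 0 1 \<and> birkhoff_orthogonal v w \<and> \<omega> v w > 0"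
  obtain c s d where c: "(c has_vector_derivative d) (at s)" "\<And>r. norm (c r) = 1" "c s = v" "d \<noteq> 0"
    using smooth_sphere_tangent[OF smooth v] by blast
  have vd: "birkhoff_orthogonal v d" using tangent_imp_birkhoff[OF c(1,2)] c(3) by simp
  have ne: "\<omega> v d \<noteq> 0" using v c(4) by (intro birkhoff_imp_symplectic_ne_0[OF dim \<omega> vd]) auto
  have "?P ((sgn (\<omega> v d) / norm d) *\<^sub>R d)"
    using ne c(4) birkhoff_orthogonal_scale[OF vd]
    by (auto simp: simps abs_sgn_eq zero_less_mult_iff zero_less_divide_iff sgn_real_def)
  moreover have "w = u" if w: "?P w" and u: "?P u" for u w
  proof -
    have "u \<noteq> 0" using u by auto
    then obtain k where k: "w = k *\<^sub>R u"
      using birkhoff_right_unique[OF dim smooth \<omega> v] w u by blast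
    have "\<bar>k\<bar> = 1" using w u k by simp
    moreover have "k > 0" using w u unfolding k by (simp add: simps zero_less_mult_iff)
    ultimately show ?thesis using k by simp
  qed
  ultimately have "\<exists>!w. ?P w" by blast
  then have "?P (birkhoff_map \<omega> v)" unfolding birkhoff_map_def by (rule theI')
  then show "birkhoff_orthogonal v (birkhoff_map \<omega> v)" "\<omega> v (birkhoff_map \<omega> v) > 0" by auto
qed

text \<open>The coordinate \<open>c\<close> is how the curvatures \<open>\<alpha>\<close> and \<open>\<kappa>\<close> are defined. It satisfies
  \<open>\<omega> v u = c * \<omega> v (birkhoff_map \<omega> v)\<close>, where the last factor is positive.\<close>

lemma sgn_birkhoff_coordinate:
  fixes \<omega> :: "'a::real_normed_vector \<Rightarrow> 'a \<Rightarrow> real"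
  assumes dim: "dim (UNIV :: 'a set) = 2" and smooth: "smooth_closed_curve (sphere (0::'a) 1)"
    and \<omega>: "symplectic_form \<omega>" and v: "norm (v::'a) = 1" and u: "birkhoff_orthogonal v u"
  shows "sgn (THE c. u = c *\<^sub>R birkhoff_map \<omega> v) = sgn (\<omega> v u)"
proof -
  let ?b = "birkhoff_map \<omega> v"
  note simps = bilinear_simps[OF symplectic_bilinear[OF \<omega>]]
  note b = birkhoff_map_props[OF dim smooth \<omega> v]
  have "?b \<noteq> 0" using b(2) by (auto simp: simps)
  then obtain c where c: "u = c *\<^sub>R ?b"
    using birkhoff_right_unique[OF dim smooth \<omega> v u b(1)] by blast
  have "(THE c. u = c *\<^sub>R ?b) = c" using c \<open>?b \<noteq> 0\<close> by (intro the_equality) auto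
  then show ?thesis using b(2) by (subst (2) c) (simp add: simps sgn_mult)
qed

section \<open>Closed fronts\<close>

lemma periodic1_has_vector_derivative:
  assumes "periodic1 f" "\<And>t. (f has_vector_derivative f' t) (at t)"
  shows "periodic1 f'"
  unfolding periodic1_def
proof
  fix t :: real
  have "((\<lambda>s. f (s + 1)) has_vector_derivative f' (t + 1)) (at t)"
    using vector_diff_chain_at[of "\<lambda>s. s + 1" 1 t f "f' (t + 1)"] assms(2)
    by (simp add: o_def has_vector_derivative_add_const)
  moreover have "(\<lambda>s. f (s + 1)) = f" using assms(1) by (auto simp: periodic1_def)
  ultimately show "f' (t + 1) = f' t" using assms(2) vector_derivative_unique_at by metis
qed

lemma bounded_bilinear_has_real_derivative:
  assumes "bounded_bilinear \<omega>" "(u has_vector_derivative u') (at t)" "(v has_vector_derivative v') (at t)"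
  shows "((\<lambda>s. \<omega> (u s) (v s)) has_real_derivative \<omega> (u t) v' + \<omega> u' (v t)) (at t)"
  unfolding has_real_derivative_iff_has_vector_derivative
  using bounded_bilinear.has_vector_derivative[OF assms] .

text \<open>Used at a cusp, where \<open>\<gamma>'\<close> vanishes: \<open>\<gamma>''\<close> is a limit of multiples of \<open>\<gamma>'\<close>, so it is still
  orthogonal to \<open>\<eta>\<close>.\<close>

lemma birkhoff_derivative_at_zero:
  fixes u g :: "real \<Rightarrow> 'a::real_normed_vector"
  assumes u: "isCont u t" and g: "(g has_vector_derivative g') (at t)" "g t = 0"
    and orth: "\<And>s. birkhoff_orthogonal (u s) (g s)"
  shows "birkhoff_orthogonal (u t) g'"
proof (rule birkhoff_limit)
  show "(u \<longlongrightarrow> u t) (at t)" using u by (simp add: isCont_def)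
  show "((\<lambda>s. (1 / (s - t)) *\<^sub>R g s) \<longlongrightarrow> g') (at t)"
  proof (rule LIM_zero_cancel, rule tendsto_norm_zero_cancel, rule Lim_transform_eventually)
    show "((\<lambda>s. norm ((g s - g t - (s - t) *\<^sub>R g') /\<^sub>R norm (s - t))) \<longlongrightarrow> 0) (at t)"
      using g(1) by (intro tendsto_norm_zero) (simp add: has_vector_derivative_def has_derivative_at_within)
    have "norm ((g s - g t - (s - t) *\<^sub>R g') /\<^sub>R norm (s - t)) = norm ((1 / (s - t)) *\<^sub>R g s - g')"
      if "s \<noteq> t" for s
    proof -
      have "(1 / (s - t)) *\<^sub>R g s - g' = (1 / (s - t)) *\<^sub>R (g s - (s - t) *\<^sub>R g')"
        using that by (simp add: scaleR_diff_right)
      then show ?thesis by (simp add: g(2) divide_inverse)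
    qed
    then show "\<forall>\<^sub>F s in at t. norm ((g s - g t - (s - t) *\<^sub>R g') /\<^sub>R norm (s - t))
        = norm ((1 / (s - t)) *\<^sub>R g s - g')"
      by (auto simp: eventually_at_filter)
  qed
  show "\<forall>\<^sub>F s in at t. birkhoff_orthogonal (u s) ((1 / (s - t)) *\<^sub>R g s)"
    by (intro always_eventually allI birkhoff_orthogonal_scale orth)
qed simp

theorem theorem4p2:
  fixes \<omega> :: "'a::real_normed_vector \<Rightarrow> 'a \<Rightarrow> real"
    and \<gamma> \<eta> :: "real \<Rightarrow> 'a"
  assumes "dim (UNIV :: 'a set) = 2"
    and "smooth_closed_curve (sphere (0::'a) 1)"
    and "contains_no_segment (sphere (0::'a) 1)"
    and "symplectic_form \<omega>"
    and "legendre_immersion \<gamma> \<eta>"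
    and "generic_front \<gamma> \<eta>"
    and "finite {t \<in> {0..<1}. inflection_point \<omega> \<eta> t}"
  shows "real (maslov_index \<omega> \<gamma> \<eta>) =
    1 / 2 * \<bar>real (card {t \<in> {0..<1}. flip \<omega> \<gamma> \<eta> t}) - real (card {t \<in> {0..<1}. flop \<omega> \<gamma> \<eta> t})\<bar>"
proof -
  note dim = assms(1) and smooth = assms(2) and \<omega> = assms(4) and gen = assms(6)
  note bb = smooth_plane_bounded_bilinear[OF dim smooth \<omega>]
  have \<gamma>: "smooth_map \<gamma>" "periodic1 \<gamma>" and \<eta>: "smooth_map \<eta>" "periodic1 \<eta>" "\<And>t. norm (\<eta> t) = 1"
    and orth: "\<And>t. birkhoff_orthogonal (\<eta> t) (vderiv \<gamma> t)"
    and imm: "\<And>t. \<not> (vderiv \<gamma> t = 0 \<and> vderiv \<eta> t = 0)"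
    using assms(5) by (auto simp: legendre_immersion_def)
  have d\<gamma>: "(\<gamma> has_vector_derivative vderiv \<gamma> t) (at t)"
    "(vderiv \<gamma> has_vector_derivative vderiv (vderiv \<gamma>) t) (at t)" for t
    using smooth_map_has_derivative[OF \<gamma>(1), of 0 t] smooth_map_has_derivative[OF \<gamma>(1), of 1 t] by auto
  have d\<eta>: "(\<eta> has_vector_derivative vderiv \<eta> t) (at t)"
    "(vderiv \<eta> has_vector_derivative vderiv (vderiv \<eta>) t) (at t)" for t
    using smooth_map_has_derivative[OF \<eta>(1), of 0 t] smooth_map_has_derivative[OF \<eta>(1), of 1 t] by auto
  have \<eta>_orth: "birkhoff_orthogonal (\<eta> t) (vderiv \<eta> t)" for t
    by (rule tangent_imp_birkhoff[OF d\<eta>(1) \<eta>(3)])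
  have \<eta>_ne: "\<eta> t \<noteq> 0" for t using \<eta>(3)[of t] by auto
  note ne_0 = birkhoff_imp_symplectic_ne_0[OF dim \<omega> _ \<eta>_ne]
  have zero_right: "\<omega> x 0 = 0" for x
    using bounded_bilinear.zero_right[OF bb] .

  \<comment> \<open>\<open>A\<close> and \<open>K\<close> have the signs of \<open>\<alpha>\<close> and \<open>\<kappa>\<close>.\<close>
  define A where "A = (\<lambda>t. \<omega> (\<eta> t) (vderiv \<gamma> t))"
  define A' where "A' = (\<lambda>t. \<omega> (\<eta> t) (vderiv (vderiv \<gamma>) t) + \<omega> (vderiv \<eta> t) (vderiv \<gamma> t))"
  define K where "K = (\<lambda>t. \<omega> (\<eta> t) (vderiv \<eta> t))"
  define K' where "K' = (\<lambda>t. \<omega> (\<eta> t) (vderiv (vderiv \<eta>) t) + \<omega> (vderiv \<eta> t) (vderiv \<eta> t))"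
  have derA: "(A has_real_derivative A' t) (at t)" for t
    unfolding A_def A'_def by (rule bounded_bilinear_has_real_derivative[OF bb d\<eta>(1) d\<gamma>(2)])
  have derK: "(K has_real_derivative K' t) (at t)" for t
    unfolding K_def K'_def by (rule bounded_bilinear_has_real_derivative[OF bb d\<eta>(1) d\<eta>(2)])
  have per: "periodic1 A" "periodic1 K"
    using \<eta>(2) periodic1_has_vector_derivative[OF \<gamma>(2) d\<gamma>(1)]
      periodic1_has_vector_derivative[OF \<eta>(2) d\<eta>(1)]
    by (auto simp: periodic1_def A_def K_def)
  have A0: "A t = 0 \<longleftrightarrow> vderiv \<gamma> t = 0" for t
    using ne_0[OF orth] by (auto simp: A_def zero_right)
  have K0: "K t = 0 \<longleftrightarrow> vderiv \<eta> t = 0" for t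
    using ne_0[OF \<eta>_orth] by (auto simp: K_def zero_right)
  have cusps: "ordinary_cusp \<gamma> t \<longleftrightarrow> A t = 0" for t
    using gen A0 unfolding generic_front_def ordinary_cusp_def singular_point_def by blast
  have simple: "A' t \<noteq> 0 \<and> K t \<noteq> 0" if "A t = 0" for t
  proof
    have \<gamma>0: "vderiv \<gamma> t = 0" using that A0 by simp
    have "lin_indep2 ((vderiv ^^ 2) \<gamma> t) ((vderiv ^^ 3) \<gamma> t)"
      using that cusps unfolding ordinary_cusp_def by blast
    then have "vderiv (vderiv \<gamma>) t \<noteq> 0"
      using dependent_zero[of "{(vderiv ^^ 2) \<gamma> t, (vderiv ^^ 3) \<gamma> t}"]
      by (auto simp: lin_indep2_def numeral_2_eq_2)
    moreover have "birkhoff_orthogonal (\<eta> t) (vderiv (vderiv \<gamma>) t)"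
      using has_vector_derivative_continuous[OF d\<eta>(1)] d\<gamma>(2) \<gamma>0 orth
      by (rule birkhoff_derivative_at_zero)
    ultimately show "A' t \<noteq> 0"
      using ne_0 by (simp add: A'_def \<gamma>0 zero_right)
    show "K t \<noteq> 0" using imm \<gamma>0 K0 by blast
  qed

  have sgn_\<alpha>: "sgn (curvature_alpha \<omega> \<gamma> \<eta> t) = sgn (A t)" for t
    unfolding curvature_alpha_def A_def by (rule sgn_birkhoff_coordinate[OF dim smooth \<omega> \<eta>(3) orth])
  have sgn_\<kappa>: "sgn (curvature_kappa \<omega> \<eta> t) = sgn (K t)" for t
    unfolding curvature_kappa_def K_def by (rule sgn_birkhoff_coordinate[OF dim smooth \<omega> \<eta>(3) \<eta>_orth])
  have infl: "inflection_point \<omega> \<eta> t \<longleftrightarrow> crosses_up K t \<or> crosses_down K t" for t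
    unfolding inflection_point_def
    using crosses_up_cong_sgn[of _ K, OF sgn_\<kappa>] crosses_down_cong_sgn[of _ K, OF sgn_\<kappa>] by blast
  have sgn_prod: "sgn (curvature_alpha \<omega> \<gamma> \<eta> t * curvature_kappa \<omega> \<eta> t) = sgn (A t * K t)" for t
    by (simp add: sgn_mult sgn_\<alpha> sgn_\<kappa>)
  have flip: "flip \<omega> \<gamma> \<eta> t \<longleftrightarrow> (crosses_up K t \<or> crosses_down K t) \<and> crosses_up (\<lambda>s. A s * K s) t" for t
    unfolding flip_def infl by (subst crosses_up_cong_sgn[OF sgn_prod]) (rule refl)
  have flop: "flop \<omega> \<gamma> \<eta> t \<longleftrightarrow> (crosses_up K t \<or> crosses_down K t) \<and> crosses_down (\<lambda>s. A s * K s) t" for t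
    unfolding flop_def infl by (subst crosses_down_cong_sgn[OF sgn_prod]) (rule refl)

  let ?Z = "{t\<in>{0..<1}. A t = 0}"
  let ?w = "cusp_word \<omega> \<gamma> \<eta>"
  have "finite {t\<in>{0..1}. A t = 0}" by (rule finite_simple_zeros[OF derA]) (use simple in blast)
  then have finZ: "finite ?Z" by (rule finite_subset[rotated]) auto
  have w: "?w = map (cusp_letter \<omega> \<eta>) (sorted_list_of_set ?Z)"
    by (simp add: cusp_word_def cusps)
  have letter: "letter_sign (cusp_letter \<omega> \<eta> t) = sgn (K t)" if "A t = 0" for t
    using simple[OF that] by (auto simp: cusp_letter_def K_def sgn_real_def)
  have "even (card ?Z)" by (rule even_card_simple_zeros[OF derA per(1)]) (use simple in blast)
  then have "even (length ?w)" by (simp add: w)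
  then have "2 * real (maslov_index \<omega> \<gamma> \<eta>) = \<bar>alternating_sum (map letter_sign ?w)\<bar>"
    unfolding maslov_index_def by (rule normal_form_exponent)
  also have "map letter_sign ?w = map (\<lambda>t. sgn (K t)) (sorted_list_of_set ?Z)"
    using finZ letter by (simp add: w)
  also have "\<bar>alternating_sum \<dots>\<bar> = \<bar>\<Sum>t\<in>?Z. sgn (A' t) * sgn (K t)\<bar>"
    by (rule alternating_sum_along_zeros[OF derA _ finZ]) (use simple in blast)
  also have "\<dots> = \<bar>real (card {t \<in> {0..<1}. flip \<omega> \<gamma> \<eta> t}) - real (card {t \<in> {0..<1}. flop \<omega> \<gamma> \<eta> t})\<bar>"
    using flips_minus_flops[OF derA derK per simple] assms(7) unfolding infl flip flop by simp
  finally show ?thesis by simp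
qed

end
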